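(* Using the order $<_1$ on $\mathcal A$, \[ C_\lambda[X(t-1);q,t]=\sum_{\sigma}(-1)^{m(\sigma)}q^{\mathrm{maj}(\sigma)}t^{p(\sigma)+\mathrm{quinv}(\sigma)}x^{|\sigma|}, \] where the sum runs over all super fillings $\sigma$ of $\mathrm{dg}(\lambda)$ in which no attacking pair of cells $u,v$ has $|\sigma(u)|=|\sigma(v)|$. Moreover $C_\lambda[X(t-1);q,t]=\sum_{\mu\le\lambda}c_{\mu\lambda}(q,t)\,m_\mu(X)$ for some $c_{\mu\lambda}(q,t)\in\mathbb Q(q,t)$, where $\le$ is dominance order and $m_\mu$ are monomial symmetric functions.
   Context: Let $\lambda=(\lambda_1\ge\dots\ge\lambda_k>0)$ be a partition; $\mathrm{dg}(\lambda)=\{(r,i):1\le i\le k,1\le r\le\lambda_i\}$, $(r,i)$ being row $r$ from the bottom and column $i$ from the left (columns bottom-justified of heights $\lambda_i$); $\mathrm{leg}((r,i))=\lambda_i-r$. $C_\lambda(X;q,t)=\sum_\sigma q^{\mathrm{maj}(\sigma)}t^{\mathrm{quinv}(\sigma)}x^\sigma$ over fillings $\sigma:\mathrm{dg}(\lambda)\to\mathbb Z_{>0}$ (the special case of the super-filling statistics below with all entries positive); it is a symmetric function, and $f[X(t-1)]$ denotes the plethysm sending power sums $p_m(X)\mapsto(t^m-1)p_m(X)$. Super fillings: $\mathcal A=\{1,\bar1,2,\bar2,\dots\}$ consists of positive letters $i$ and negative letters $\bar i$, with $|i|=|\bar i|=i$. The total order $<_1$ on $\mathcal A\cup\{0\}$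 is $0<1<\bar1<2<\bar2<\cdots$ (and $<_2$ is $0<1<2<3<\cdots<\bar3<\bar2<\bar1$). For the chosen order, $I(a,b)=1$ if $a>b$ or $a=b$ is negative, and $I(a,b)=0$ if $a<b$ or $a=b$ is positive. A super filling is a map $\sigma:\mathrm{dg}(\lambda)\to\mathcal A$. A cell $u=(r,i)$ with $r>1$ is a descent if $I(\sigma(u),\sigma((r-1,i)))=1$, and $\mathrm{maj}(\sigma)=\sum_{\text{descents }u}(\mathrm{leg}(u)+1)$. A triple is either three cells $(r+1,i),(r,i),(r,j)$ with $i<j$, or (degenerate) two cells $(r,i),(r,j)$ with $i<j$ and $\lambda_i=r$; with $a=\sigma((r+1,i))$ ($a=0$ if degenerate), $b=\sigma((r,i))$, $c=\sigma((r,j))$, it is a quinv triple iff exactly one of the three conditions $I(a,b)=1$, $I(c,b)=0$, $I(a,c)=0$ holds; $\mathrm{quinv}(\sigma)$ is the number of quinv triples. $|\sigma|$ is the filling $u\mapsto|\sigma(u)|$, $x^{|\sigma|}=\prod_u x_{|\sigma(u)|}$, and $p(\sigma)$, $m(\sigma)$ are the numbers of cells with positive, resp. negative, entries. Two distinct cells $(r,i)$ and $(r',j)$ with $i<j$ form an attacking pair if $r=r'$ or $r=r'+1$. *)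

theory Defs
  imports Main "HOL-Library.Multiset"
begin

definition is_partition :: "nat list \<Rightarrow> bool" where
  "is_partition lam \<longleftrightarrow> sorted_wrt (\<ge>) lam \<and> (\<forall>x\<in>set lam. 0 < x)"

(* column i (1-indexed from the left) has height lam_i *)
definition col_ht :: "nat list \<Rightarrow> nat \<Rightarrow> nat" where
  "col_ht lam i = lam ! (i - 1)"

(* cells (r,i): row r from the bottom, column i from the left *)
definition dg :: "nat list \<Rightarrow> (nat \<times> nat) set" where
  "dg lam = {(r, i). 1 \<le> i \<and> i \<le> length lam \<and> 1 \<le> r \<and> r \<le> col_ht lam i}"

definition leg :: "nat list \<Rightarrow> nat \<times> nat \<Rightarrow> nat" where
  "leg lam u = col_ht lam (snd u) - fst u"

(* a letter (k, False) is the positive letter k, (k, True) is the negative letter bar k;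
   (0, False) plays the role of the extra symbol 0 *)
type_synonym letter = "nat \<times> bool"

definition zero_letter :: letter where "zero_letter = (0, False)"

(* rank in the total order 0 < 1 < bar1 < 2 < bar2 < ... *)
definition rank1 :: "letter \<Rightarrow> nat" where
  "rank1 a = 2 * fst a + (if snd a then 1 else 0)"

definition Iv :: "letter \<Rightarrow> letter \<Rightarrow> bool" where
  "Iv a b \<longleftrightarrow> rank1 a > rank1 b \<or> (a = b \<and> snd a)"

(* super fillings of dg(lam), normalised to zero_letter outside the diagram *)
definition superfillings :: "nat list \<Rightarrow> (nat \<times> nat \<Rightarrow> letter) set" where
  "superfillings lam = {\<sigma>. (\<forall>u\<in>dg lam. 1 \<le> fst (\<sigma> u)) \<and> (\<forall>u. u \<notin> dg lam \<longrightarrow> \<sigma> u = zero_letter)}"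

definition posfillings :: "nat list \<Rightarrow> (nat \<times> nat \<Rightarrow> letter) set" where
  "posfillings lam = {\<sigma> \<in> superfillings lam. \<forall>u\<in>dg lam. \<not> snd (\<sigma> u)}"

definition is_descent :: "nat list \<Rightarrow> (nat \<times> nat \<Rightarrow> letter) \<Rightarrow> nat \<times> nat \<Rightarrow> bool" where
  "is_descent lam \<sigma> u \<longleftrightarrow> u \<in> dg lam \<and> fst u > 1 \<and> Iv (\<sigma> u) (\<sigma> (fst u - 1, snd u))"

definition maj :: "nat list \<Rightarrow> (nat \<times> nat \<Rightarrow> letter) \<Rightarrow> nat" where
  "maj lam \<sigma> = (\<Sum>u \<in> {u. is_descent lam \<sigma> u}. leg lam u + 1)"

definition exactly_one :: "bool \<Rightarrow> bool \<Rightarrow> bool \<Rightarrow> bool" where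
  "exactly_one x y z \<longleftrightarrow> (x \<and> \<not> y \<and> \<not> z) \<or> (\<not> x \<and> y \<and> \<not> z) \<or> (\<not> x \<and> \<not> y \<and> z)"

definition is_quinv_triple :: "nat list \<Rightarrow> (nat \<times> nat \<Rightarrow> letter) \<Rightarrow> nat \<times> nat \<times> nat \<Rightarrow> bool" where
  "is_quinv_triple lam \<sigma> x = (case x of (r, i, j) \<Rightarrow>
     (r, i) \<in> dg lam \<and> (r, j) \<in> dg lam \<and> i < j \<and>
     ((r + 1, i) \<in> dg lam \<or> col_ht lam i = r) \<and>
     (let a = (if (r + 1, i) \<in> dg lam then \<sigma> (r + 1, i) else zero_letter);
          b = \<sigma> (r, i); c = \<sigma> (r, j)
      in exactly_one (Iv a b) (\<not> Iv c b) (\<not> Iv a c)))"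

definition quinv :: "nat list \<Rightarrow> (nat \<times> nat \<Rightarrow> letter) \<Rightarrow> nat" where
  "quinv lam \<sigma> = card {x. is_quinv_triple lam \<sigma> x}"

definition npos :: "nat list \<Rightarrow> (nat \<times> nat \<Rightarrow> letter) \<Rightarrow> nat" where
  "npos lam \<sigma> = card {u \<in> dg lam. \<not> snd (\<sigma> u)}"

definition nneg :: "nat list \<Rightarrow> (nat \<times> nat \<Rightarrow> letter) \<Rightarrow> nat" where
  "nneg lam \<sigma> = card {u \<in> dg lam. snd (\<sigma> u)}"

(* exponent vector of x^{|sigma|}: alpha k = number of cells with |sigma(u)| = k *)
definition content :: "nat list \<Rightarrow> (nat \<times> nat \<Rightarrow> letter) \<Rightarrow> nat \<Rightarrow> nat" where
  "content lam \<sigma> = (\<lambda>k. card {u \<in> dg lam. fst (\<sigma> u) = k})"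

definition attacking :: "nat \<times> nat \<Rightarrow> nat \<times> nat \<Rightarrow> bool" where
  "attacking u v \<longleftrightarrow> u \<noteq> v \<and> snd u < snd v \<and> (fst u = fst v \<or> fst u = fst v + 1)"

definition nonattacking :: "nat list \<Rightarrow> (nat \<times> nat \<Rightarrow> letter) \<Rightarrow> bool" where
  "nonattacking lam \<sigma> \<longleftrightarrow>
     (\<forall>u\<in>dg lam. \<forall>v\<in>dg lam. attacking u v \<longrightarrow> fst (\<sigma> u) \<noteq> fst (\<sigma> v))"

section \<open>Formal series in x_1, x_2, ... as coefficient functions on exponent vectors\<close>

definition C_ser :: "nat list \<Rightarrow> 'a::comm_ring_1 \<Rightarrow> 'a \<Rightarrow> (nat \<Rightarrow> nat) \<Rightarrow> 'a" where
  "C_ser lam q t \<alpha> =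
     (\<Sum>\<sigma> \<in> {\<sigma> \<in> posfillings lam. content lam \<sigma> = \<alpha>}. q ^ maj lam \<sigma> * t ^ quinv lam \<sigma>)"

definition S_ser :: "nat list \<Rightarrow> 'a::comm_ring_1 \<Rightarrow> 'a \<Rightarrow> (nat \<Rightarrow> nat) \<Rightarrow> 'a" where
  "S_ser lam q t \<alpha> =
     (\<Sum>\<sigma> \<in> {\<sigma> \<in> superfillings lam. nonattacking lam \<sigma> \<and> content lam \<sigma> = \<alpha>}.
        (-1) ^ nneg lam \<sigma> * q ^ maj lam \<sigma> * t ^ (npos lam \<sigma> + quinv lam \<sigma>))"

(* coefficient of x^alpha in the power sum p_mu = prod_i p_{mu_i}, p_m = sum_{k>=1} x_k^m *)
definition pcoeff :: "nat list \<Rightarrow> (nat \<Rightarrow> nat) \<Rightarrow> nat" where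
  "pcoeff mu \<alpha> = card {\<phi> :: nat \<Rightarrow> nat.
      (\<forall>i < length mu. 1 \<le> \<phi> i) \<and> (\<forall>i. length mu \<le> i \<longrightarrow> \<phi> i = 0) \<and>
      (\<forall>k. \<alpha> k = (\<Sum>i \<in> {i. i < length mu \<and> \<phi> i = k}. mu ! i))}"

(* coefficient of x^alpha in the monomial symmetric function m_mu *)
definition mcoeff :: "nat list \<Rightarrow> (nat \<Rightarrow> nat) \<Rightarrow> nat" where
  "mcoeff mu \<alpha> = (if \<alpha> 0 = 0 \<and> finite {k. \<alpha> k \<noteq> 0} \<and>
                       image_mset \<alpha> (mset_set {k. \<alpha> k \<noteq> 0}) = mset mu then 1 else 0)"

(* g = f[X(t-1)]: f = sum_mu a_mu p_mu (finite), g = sum_mu a_mu prod_i (t^{mu_i} - 1) p_mu *)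
definition pleth_Xt1 :: "'a::field \<Rightarrow> ((nat \<Rightarrow> nat) \<Rightarrow> 'a) \<Rightarrow> ((nat \<Rightarrow> nat) \<Rightarrow> 'a) \<Rightarrow> bool" where
  "pleth_Xt1 t f g \<longleftrightarrow> (\<exists>a :: nat list \<Rightarrow> 'a.
     finite {mu. a mu \<noteq> 0} \<and> (\<forall>mu. a mu \<noteq> 0 \<longrightarrow> is_partition mu) \<and>
     (\<forall>\<alpha>. f \<alpha> = (\<Sum>mu \<in> {mu. a mu \<noteq> 0}. a mu * of_nat (pcoeff mu \<alpha>))) \<and>
     (\<forall>\<alpha>. g \<alpha> = (\<Sum>mu \<in> {mu. a mu \<noteq> 0}.
                   a mu * (\<Prod>i < length mu. t ^ (mu ! i) - 1) * of_nat (pcoeff mu \<alpha>))))"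

definition dominated :: "nat list \<Rightarrow> nat list \<Rightarrow> bool" where
  "dominated mu lam \<longleftrightarrow> sum_list mu = sum_list lam \<and>
     (\<forall>i. sum_list (take i mu) \<le> sum_list (take i lam))"

end

theory Submission
  imports "HOL-Combinatorics.Permutations" "HOL-Library.Product_Lexorder"
    "HOL-Computational_Algebra.Polynomial" Defs
begin

text \<open>
  Symmetry. For \<open>t \<noteq> 0\<close> the weight \<open>q^maj t^quinv\<close> is a product over pairs of cells
  \<open>u\<close>, \<open>v\<close> with \<open>I(u, v) = 1\<close>: a quinv triple is counted by \<open>I(c, b) + I(a, c) - I(a, b)\<close>, so an attacking
  pair contributes \<open>t\<close> and a vertical pair contributes a monomial in \<open>q\<close> and \<open>1/t\<close>. In the reading order a cell
  attacks precisely the cells between itself and the cell below it. Fixing all letters except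
  \<open>k\<close> and \<open>k + 1\<close> leaves a two-letter sum over such an interval graph, which is seen to be symmetric by
  deleting one edge at a time. The case \<open>t = 0\<close> follows because both sides are polynomials in \<open>t\<close>.

  Superization. Toggling the sign of the last cell with absolute value \<open>k\<close> changes no \<open>I(u, v)\<close> with
  \<open>u\<close> before \<open>v\<close>, so signed sums over super fillings satisfy the cancellation law of
  \<open>f[X - Y]\<close>. Power sums in a signed alphabet satisfy the same law, and the law determines the
  signed sums from the purely positive ones. Hence every power sum expansion of \<open>C\<close>
  yields the signed sum over all super fillings as \<open>C[X(t - 1)]\<close>.

  Cancellation. Toggling the last cell that attacks a later cell with the same absolute value
  changes quinv by exactly one and leaves maj alone, which removes all fillings that are not
  non-attacking. In a non-attacking filling every row has distinct absolute values; this gives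
  the dominance bound.
\<close>

text \<open>The plethysm is a relation that any power sum expansion may witness. So an expansion
  must exist, which is where the symmetry of \<open>C_ser\<close> enters, and every expansion must
  lead to the same series. For the latter, signed sums over two kinds of index sets are compared,
  the cells of the diagram and the parts of a partition; the locale \<open>superization\<close>
  isolates what they share. Both involutions rest on one feature of the order: at equal absolute
  values \<open>Iv a b\<close> depends only on the sign of \<open>a\<close>. Toggling a cell is
  therefore visible only against later cells, in the reading order, of the same absolute value. One
  involution picks a cell with no such partner among the pairs that matter, the other a cell with
  exactly one. The powers of \<open>1/t\<close> come from the term \<open>Iv a b\<close>, which
  enters with a minus sign and recurs in every triple that has the same two cells on the
  left.\<close>

section \<open>Two-letter symmetry\<close>

text \<open>The pair \<open>(i, j)\<close> in the proof is chosen so that, once \<open>i \<in> S\<close> and \<open>j \<notin> S\<close>, every other cell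
  contributes the same factor together with \<open>i\<close> and \<open>j\<close> whether or not it lies in \<open>S\<close>.\<close>

lemma two_letter_symmetry:
  fixes w :: "'b::linorder \<Rightarrow> 'b \<Rightarrow> 'a::comm_ring_1"
  assumes "finite V"
    and "\<forall>u\<in>V. \<forall>v\<in>V. w u v \<noteq> 1 \<longrightarrow> v < u \<and> (\<forall>x\<in>V. v < x \<and> x < u \<longrightarrow> w u x = t \<and> w x v = t)"
  shows "(\<Sum>S\<in>Pow V. g (card S) * (\<Prod>u\<in>S. \<Prod>v\<in>V-S. w u v)) =
         (\<Sum>S\<in>Pow V. g (card (V - S)) * (\<Prod>u\<in>S. \<Prod>v\<in>V-S. w u v))"
  using assms
proof (induction "card {(u,v)\<in>V\<times>V. w u v \<noteq> 1}" arbitrary: V w g rule: less_induct)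
  case less
  note fin = less.prems(1) and H = less.prems(2)
  show ?case
  proof (cases "\<forall>u\<in>V. \<forall>v\<in>V. w u v = 1")
    case True
    have one: "(\<Prod>u\<in>S. \<Prod>v\<in>V-S. w u v) = 1" if "S \<in> Pow V" for S
      using that True by (intro prod.neutral ballI) blast
    have "(\<Sum>S\<in>Pow V. g (card S)) = (\<Sum>S\<in>Pow V. g (card (V - S)))"
      by (rule sum.reindex_bij_witness[of _ "\<lambda>S. V - S" "\<lambda>S. V - S"]) (auto simp: double_diff)
    then show ?thesis using one by simp
  next
    case False
    define i where "i = Max {u\<in>V. \<exists>v\<in>V. w u v \<noteq> 1}"
    define j where "j = Min {v\<in>V. w i v \<noteq> 1}"
    have "i \<in> {u\<in>V. \<exists>v\<in>V. w u v \<noteq> 1}"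
      unfolding i_def using fin False by (intro Max_in) auto
    then have iV: "i \<in> V" and ex: "\<exists>v\<in>V. w i v \<noteq> 1" by auto
    have "j \<in> {v\<in>V. w i v \<noteq> 1}"
      unfolding j_def using fin ex by (intro Min_in) auto
    then have jV: "j \<in> V" and wij: "w i j \<noteq> 1" by auto
    have i_max: "w u v = 1" if "u \<in> V" "v \<in> V" "i < u" for u v
    proof (rule ccontr)
      assume "w u v \<noteq> 1"
      then have "u \<le> i" unfolding i_def using fin that by (intro Max_ge) auto
      then show False using that by simp
    qed
    have j_min: "w i v = 1" if "v \<in> V" "v < j" for v
    proof (rule ccontr)
      assume "w i v \<noteq> 1"
      then have "j \<le> v" unfolding j_def using fin that by (intro Min_le) auto
      then show False using that by simp
    qed
    have ji: "j < i" using H iV jV wij by blast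
    have mid: "w i x = t" "w x j = t" if "x \<in> V" "j < x" "x < i" for x
      using H iV jV wij that by blast+
    define w' where "w' = (\<lambda>u v. if u = i \<and> v = j then 1 else w u v)"
    define V' where "V' = V - {i, j}"
    define c where "c = card {x\<in>V. j < x \<and> x < i}"
    define X where "X = (\<lambda>U (z::'b \<Rightarrow> 'b \<Rightarrow> 'a) S. \<Prod>u\<in>S. \<Prod>v\<in>U-S. z u v)"
    have finV': "finite V'" using fin V'_def by simp
    have "{(u,v)\<in>V\<times>V. w' u v \<noteq> 1} \<subset> {(u,v)\<in>V\<times>V. w u v \<noteq> 1}"
      using iV jV wij by (auto simp: w'_def)
    then have less1: "card {(u,v)\<in>V\<times>V. w' u v \<noteq> 1} < card {(u,v)\<in>V\<times>V. w u v \<noteq> 1}"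
      by (intro psubset_card_mono) (auto intro: finite_subset[OF _ finite_cartesian_product[OF fin fin]])
    have "{(u,v)\<in>V'\<times>V'. w u v \<noteq> 1} \<subset> {(u,v)\<in>V\<times>V. w u v \<noteq> 1}"
      using iV jV wij by (auto simp: V'_def)
    then have less2: "card {(u,v)\<in>V'\<times>V'. w u v \<noteq> 1} < card {(u,v)\<in>V\<times>V. w u v \<noteq> 1}"
      by (intro psubset_card_mono) (auto intro: finite_subset[OF _ finite_cartesian_product[OF fin fin]])
    \<comment> \<open>Deleting the pair could spoil the hypothesis only if \<open>i\<close> had a
      nontrivial partner below \<open>j\<close>, or \<open>j\<close> one above \<open>i\<close>. The
      extremal choice of \<open>i\<close> and \<open>j\<close> excludes both.\<close>
    have H1: "\<forall>u\<in>V. \<forall>v\<in>V. w' u v \<noteq> 1 \<longrightarrow> v < u \<and> (\<forall>x\<in>V. v < x \<and> x < u \<longrightarrow> w' u x = t \<and> w' x v = t)"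
    proof (intro ballI impI)
      fix u v assume uv: "u \<in> V" "v \<in> V" "w' u v \<noteq> 1"
      then have w: "w u v \<noteq> 1" by (auto simp: w'_def split: if_splits)
      have base: "v < u" "\<forall>x\<in>V. v < x \<and> x < u \<longrightarrow> w u x = t \<and> w x v = t" using H uv w by blast+
      have "\<not> (u = i \<and> v < j)" using j_min uv w by blast
      moreover have "\<not> (v = j \<and> i < u)" using i_max uv w by blast
      ultimately show "v < u \<and> (\<forall>x\<in>V. v < x \<and> x < u \<longrightarrow> w' u x = t \<and> w' x v = t)"
        using base by (auto simp: w'_def)
    qed
    have H2: "\<forall>u\<in>V'. \<forall>v\<in>V'. w u v \<noteq> 1 \<longrightarrow> v < u \<and> (\<forall>x\<in>V'. v < x \<and> x < u \<longrightarrow> w u x = t \<and> w x v = t)"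
      using H by (auto simp: V'_def)
    have diff: "X V w S = X V w' S + (if i \<in> S \<and> j \<notin> S then (w i j - 1) * t ^ c * X V' w (S - {i}) else 0)"
      if SV: "S \<subseteq> V" for S
    proof (cases "i \<in> S \<and> j \<notin> S")
      case False
      then show ?thesis unfolding X_def w'_def by (auto intro!: prod.cong)
    next
      case True
      define R where "R = S - {i}"
      have S: "S = insert i R" "i \<notin> R" "j \<notin> R" "R \<subseteq> V'" "finite R"
        using True SV fin by (auto simp: R_def V'_def intro: finite_subset)
      have VS: "V - S = insert j (V' - R)" "j \<notin> V' - R" "finite (V' - R)"
        using True SV jV fin ji by (auto simp: R_def V'_def)
      have split: "X V z S = z i j * ((\<Prod>v\<in>V'-R. z i v) * (\<Prod>u\<in>R. z u j)) * X V' z R" for z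
        unfolding X_def VS(1) using S VS by (simp add: prod.distrib algebra_simps)
      have pi: "(\<Prod>v\<in>V'-R. w i v) = t ^ card {v\<in>V'-R. j < v \<and> v < i}"
      proof -
        have "(\<Prod>v\<in>V'-R. w i v) = (\<Prod>v\<in>V'-R. if j < v \<and> v < i then t else 1)"
        proof (rule prod.cong[OF refl])
          fix v assume v: "v \<in> V' - R"
          then have "v \<in> V" "v \<noteq> i" "v \<noteq> j" by (auto simp: V'_def)
          moreover have "w i v = 1" if "i < v" using H iV \<open>v \<in> V\<close> that less_asym by blast
          ultimately show "w i v = (if j < v \<and> v < i then t else 1)"
            using mid[of v] j_min[of v]
            by (cases v j rule: linorder_cases; cases v i rule: linorder_cases) auto
        qed
        also have "\<dots> = (\<Prod>v\<in>{v\<in>V'-R. j < v \<and> v < i}. t)" using VS(3) by (simp add: prod.If_cases Int_def)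
        finally show ?thesis by simp
      qed
      have pj: "(\<Prod>u\<in>R. w u j) = t ^ card {v\<in>R. j < v \<and> v < i}"
      proof -
        have "(\<Prod>u\<in>R. w u j) = (\<Prod>v\<in>R. if j < v \<and> v < i then t else 1)"
        proof (rule prod.cong[OF refl])
          fix v assume v: "v \<in> R"
          then have "v \<in> V" "v \<noteq> i" "v \<noteq> j" using S by (auto simp: V'_def)
          moreover have "w v j = 1" if "v < j" using H jV \<open>v \<in> V\<close> that less_asym by blast
          ultimately show "w v j = (if j < v \<and> v < i then t else 1)"
            using mid[of v] i_max[of v j] jV
            by (cases v j rule: linorder_cases; cases v i rule: linorder_cases) auto
        qed
        also have "\<dots> = (\<Prod>v\<in>{v\<in>R. j < v \<and> v < i}. t)" using S(5) by (simp add: prod.If_cases Int_def)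
        finally show ?thesis by simp
      qed
      \<comment> \<open>A cell strictly between \<open>j\<close> and \<open>i\<close> contributes
        \<open>t\<close> exactly once: against \<open>i\<close> if it lies outside \<open>S\<close>,
        against \<open>j\<close> if it lies inside.\<close>
      have "{x\<in>V. j < x \<and> x < i} = {v\<in>V'-R. j < v \<and> v < i} \<union> {v\<in>R. j < v \<and> v < i}"
        using S(4) by (auto simp: V'_def)
      then have c: "c = card {v\<in>V'-R. j < v \<and> v < i} + card {v\<in>R. j < v \<and> v < i}"
        unfolding c_def using VS(3) S(5) by (simp add: card_Un_disjoint[symmetric] disjoint_iff)
      have pw: "(\<Prod>v\<in>V'-R. w i v) * (\<Prod>u\<in>R. w u j) = t ^ c"
        using pi pj c by (simp add: power_add)
      have "(\<Prod>v\<in>V'-R. w' i v) = (\<Prod>v\<in>V'-R. w i v)" "(\<Prod>u\<in>R. w' u j) = (\<Prod>u\<in>R. w u j)" "X V' w' R = X V' w R"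
        unfolding X_def w'_def using S VS by (auto intro!: prod.cong)
      then have "X V w' S = t ^ c * X V' w R" using split[of w'] pw by (simp add: w'_def)
      moreover have "X V w S = w i j * t ^ c * X V' w R" using split[of w] pw by simp
      ultimately show ?thesis using True by (simp add: R_def algebra_simps)
    qed
    have key: "(\<Sum>S\<in>Pow V. f S * X V w S) =
        (\<Sum>S\<in>Pow V. f S * X V w' S) + (w i j - 1) * t ^ c * (\<Sum>S\<in>Pow V'. f (insert i S) * X V' w S)" for f
    proof -
      have "(\<Sum>S\<in>Pow V. f S * X V w S) = (\<Sum>S\<in>Pow V. f S * X V w' S) +
         (\<Sum>S\<in>Pow V. if i \<in> S \<and> j \<notin> S then f S * ((w i j - 1) * t ^ c * X V' w (S - {i})) else 0)"
        unfolding sum.distrib[symmetric] by (intro sum.cong refl) (auto simp: diff algebra_simps)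
      also have "(\<Sum>S\<in>Pow V. if i \<in> S \<and> j \<notin> S then f S * ((w i j - 1) * t ^ c * X V' w (S - {i})) else 0)
         = (\<Sum>S\<in>{S\<in>Pow V. i \<in> S \<and> j \<notin> S}. f S * ((w i j - 1) * t ^ c * X V' w (S - {i})))"
        using fin by (simp add: sum.If_cases Int_def)
      also have "\<dots> = (\<Sum>S\<in>Pow V'. f (insert i S) * ((w i j - 1) * t ^ c * X V' w S))"
        using iV ji by (intro sum.reindex_bij_witness[of _ "insert i" "\<lambda>S. S - {i}"])
          (auto simp: V'_def insert_absorb)
      finally show ?thesis by (simp add: sum_distrib_left algebra_simps)
    qed
    have e1: "(\<Sum>S\<in>Pow V. g (card S) * X V w' S) = (\<Sum>S\<in>Pow V. g (card (V - S)) * X V w' S)"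
      unfolding X_def using less.hyps[OF less1 fin H1] .
    \<comment> \<open>One of \<open>i\<close>, \<open>j\<close> joins \<open>S\<close> and the other
      the complement, so both cardinalities grow by one. This is why \<open>g\<close> is arbitrary
      in the induction: it is replaced by its shift.\<close>
    have e2: "(\<Sum>S\<in>Pow V'. g (card (insert i S)) * X V' w S) = (\<Sum>S\<in>Pow V'. g (card (V - insert i S)) * X V' w S)"
    proof -
      have "card (insert i S) = Suc (card S)" "card (V - insert i S) = Suc (card (V' - S))"
        if "S \<in> Pow V'" for S
      proof -
        have "i \<notin> S" "finite S" using that finV' by (auto simp: V'_def intro: finite_subset)
        then show "card (insert i S) = Suc (card S)" by simp
        have "V - insert i S = insert j (V' - S)" "j \<notin> V' - S"
          using that jV ji by (auto simp: V'_def)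
        then show "card (V - insert i S) = Suc (card (V' - S))" using finV' by simp
      qed
      then show ?thesis
        using less.hyps[OF less2 finV' H2, of "\<lambda>n. g (Suc n)"] unfolding X_def by simp
    qed
    show ?thesis using key[of "\<lambda>S. g (card S)"] key[of "\<lambda>S. g (card (V - S))"] e1 e2
      unfolding X_def by simp
  qed
qed

section \<open>Symmetric coefficient functions and power sums\<close>

text \<open>Index 0 belongs to no variable, hence \<open>1 \<le> k\<close>. Adjacent transpositions
  generate all finite permutations of the remaining indices.\<close>

definition adj_symmetric :: "((nat \<Rightarrow> nat) \<Rightarrow> 'a) \<Rightarrow> bool" where
  "adj_symmetric F \<longleftrightarrow> (\<forall>\<alpha> k. 1 \<le> k \<longrightarrow> F (\<alpha> \<circ> transpose k (Suc k)) = F \<alpha>)"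

definition is_exponent :: "(nat \<Rightarrow> nat) \<Rightarrow> bool" where
  "is_exponent \<alpha> \<longleftrightarrow> \<alpha> 0 = 0 \<and> finite {k. \<alpha> k \<noteq> 0}"

definition nzparts :: "(nat \<Rightarrow> nat) \<Rightarrow> nat multiset" where
  "nzparts \<alpha> = image_mset \<alpha> (mset_set {k. \<alpha> k \<noteq> 0})"

text \<open>The exponent in which the variable \<open>x_i\<close> carries the \<open>i\<close>-th
  part. It represents all exponents with the same nonzero parts, so the coefficients of a symmetric
  series are read off here.\<close>

definition pvec :: "nat list \<Rightarrow> nat \<Rightarrow> nat" where
  "pvec mu k = (if 1 \<le> k \<and> k \<le> length mu then mu ! (k - 1) else 0)"

text \<open>With \<open>b = a + d\<close>, the transposition of \<open>a\<close> and
  \<open>Suc b\<close> is that of \<open>a\<close> and \<open>b\<close> conjugated by that of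
  \<open>b\<close> and \<open>Suc b\<close>.\<close>

lemma adj_symmetric_transpose_add:
  assumes "adj_symmetric F" "1 \<le> a"
  shows "F (\<alpha> \<circ> transpose a (a + d)) = F \<alpha>"
proof (induction d arbitrary: \<alpha>)
  case 0
  then show ?case by simp
next
  case (Suc d)
  define b where "b = a + d"
  have step: "F (\<alpha> \<circ> transpose b (Suc b)) = F \<alpha>" for \<alpha>
    using assms by (simp add: adj_symmetric_def b_def)
  show ?case
  \<comment> \<open>For \<open>d = 0\<close> the inner transposition is the identity and the
    conjugation formula fails; this case is a single adjacent step.\<close>
  proof (cases "d = 0")
    case True
    then show ?thesis using step[of \<alpha>] by (simp add: b_def comp_def)
  next
    case False
    have "transpose a (Suc b) = transpose b (Suc b) \<circ> transpose a b \<circ> transpose b (Suc b)"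
      using False by (auto simp: fun_eq_iff transpose_def b_def)
    then have "\<alpha> \<circ> transpose a (a + Suc d) = ((\<alpha> \<circ> transpose b (Suc b)) \<circ> transpose a b) \<circ> transpose b (Suc b)"
      by (simp add: b_def o_assoc)
    then show ?thesis by (simp only: step Suc.IH[folded b_def])
  qed
qed

lemma adj_symmetric_permutes:
  assumes "adj_symmetric F" "p permutes A" "finite A" "0 \<notin> A"
  shows "F (\<alpha> \<circ> p) = F \<alpha>"
  using assms(2,3)
proof (induction arbitrary: \<alpha> rule: permutes_induct)
  case id
  then show ?case by simp
next
  case (swap a b p)
  have tr: "F (\<beta> \<circ> transpose a b) = F \<beta>" for \<beta>
  proof (cases "a \<le> b")
    case True
    moreover have "1 \<le> a" using swap(1) assms(4) by (cases a) auto
    ultimately show ?thesis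
      using adj_symmetric_transpose_add[OF assms(1), of a \<beta> "b - a"] by simp
  next
    case False
    moreover have "1 \<le> b" using swap(2) assms(4) by (cases b) auto
    ultimately show ?thesis
      using adj_symmetric_transpose_add[OF assms(1), of b \<beta> "a - b"] by (simp add: transpose_commute)
  qed
  have "F (\<alpha> \<circ> (transpose a b \<circ> p)) = F ((\<alpha> \<circ> transpose a b) \<circ> p)" by (simp add: o_assoc)
  also have "\<dots> = F (\<alpha> \<circ> transpose a b)" by (rule swap.IH)
  also have "\<dots> = F \<alpha>" by (rule tr)
  finally show ?case .
qed

text \<open>Padding by zeros lets exponents with different supports be compared on one finite
  set.\<close>

lemma image_mset_superset_nzparts:
  assumes "finite A" "{k. \<alpha> k \<noteq> 0} \<subseteq> A"
  shows "image_mset \<alpha> (mset_set A) = nzparts \<alpha> + replicate_mset (card A - size (nzparts \<alpha>)) 0"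
proof -
  define B where "B = {k. \<alpha> k \<noteq> 0}"
  have fB: "finite B" "B \<subseteq> A" using assms by (auto simp: B_def intro: finite_subset)
  have "mset_set A = mset_set B + mset_set (A - B)"
    using assms fB by (metis Diff_disjoint Un_Diff_cancel Un_absorb1 finite_Diff mset_set_Union)
  moreover have "image_mset \<alpha> (mset_set (A - B)) = image_mset (\<lambda>_. 0) (mset_set (A - B))"
    using assms by (intro image_mset_cong) (auto simp: B_def)
  moreover have "card (A - B) = card A - size (nzparts \<alpha>)"
    unfolding nzparts_def B_def[symmetric] using fB by (simp add: card_Diff_subset)
  ultimately show ?thesis
    unfolding nzparts_def B_def[symmetric] using assms by (simp add: image_mset_const_eq)
qed

text \<open>On the union of the supports both exponents take the same multiset of values, so they
  differ by a permutation of that set, which avoids 0.\<close>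

lemma adj_symmetric_nzparts:
  assumes "adj_symmetric F" "is_exponent \<alpha>" "is_exponent \<beta>" "nzparts \<alpha> = nzparts \<beta>"
  shows "F \<alpha> = F \<beta>"
proof -
  define A where "A = {k. \<alpha> k \<noteq> 0} \<union> {k. \<beta> k \<noteq> 0}"
  have fA: "finite A" "0 \<notin> A" using assms by (auto simp: A_def is_exponent_def)
  have "image_mset \<alpha> (mset_set A) = image_mset \<beta> (mset_set A)"
    using image_mset_superset_nzparts[of A \<alpha>] image_mset_superset_nzparts[of A \<beta>] fA assms(4)
    by (simp add: A_def)
  then obtain p where p: "p permutes A" "\<forall>x\<in>A. \<alpha> x = \<beta> (p x)"
    by (metis image_mset_eq_implies_permutes fA(1))
  have "\<alpha> = \<beta> \<circ> p"
  proof
    fix x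
    show "\<alpha> x = (\<beta> \<circ> p) x"
    proof (cases "x \<in> A")
      case False
      then have "p x = x" using p(1) by (simp add: permutes_def)
      then show ?thesis using False by (auto simp: A_def)
    qed (use p in simp)
  qed
  then show ?thesis using adj_symmetric_permutes[OF assms(1) p(1) fA] by simp
qed

section \<open>Partitions as representatives of exponents\<close>

lemma mset_eq_image_nth: "image_mset ((!) xs) (mset_set {..<length xs}) = mset xs"
proof -
  have "mset xs = mset (map ((!) xs) [0..<length xs])" by (simp only: map_nth)
  then show ?thesis by (simp add: atLeast0LessThan)
qed

lemma support_pvec:
  assumes "is_partition mu"
  shows "{k. pvec mu k \<noteq> 0} = Suc ` {..<length mu}"
proof (intro equalityI subsetI)
  fix k assume "k \<in> {k. pvec mu k \<noteq> 0}"
  then show "k \<in> Suc ` {..<length mu}" by (cases k) (auto simp: pvec_def split: if_splits)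
next
  fix k assume "k \<in> Suc ` {..<length mu}"
  then obtain i where "k = Suc i" "i < length mu" by auto
  then show "k \<in> {k. pvec mu k \<noteq> 0}" using assms nth_mem[of i mu]
    by (auto simp: pvec_def is_partition_def)
qed

lemma is_exponent_pvec: "is_partition mu \<Longrightarrow> is_exponent (pvec mu)"
  by (simp add: is_exponent_def support_pvec) (simp add: pvec_def)

lemma nzparts_pvec:
  assumes "is_partition mu"
  shows "nzparts (pvec mu) = mset mu"
proof -
  have "nzparts (pvec mu) = image_mset (pvec mu \<circ> Suc) (mset_set {..<length mu})"
    unfolding nzparts_def support_pvec[OF assms]
    by (simp add: image_mset_mset_set[symmetric] multiset.map_comp)
  also have "\<dots> = image_mset ((!) mu) (mset_set {..<length mu})"
    by (intro image_mset_cong) (auto simp: pvec_def)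
  finally show ?thesis by (simp add: mset_eq_image_nth)
qed

lemma is_partition_mset_eq:
  assumes "is_partition mu" "is_partition nu" "mset mu = mset nu"
  shows "mu = nu"
proof -
  have "sorted (rev mu)" "sorted (rev nu)"
    using assms by (simp_all add: is_partition_def sorted_wrt_rev)
  then have "rev mu = rev nu"
    by (metis assms(3) mset_rev properties_for_sort)
  then show ?thesis by simp
qed

lemma ex_partition_nzparts:
  assumes "is_exponent \<alpha>"
  obtains mu where "is_partition mu" "mset mu = nzparts \<alpha>"
proof
  let ?mu = "rev (sorted_list_of_multiset (nzparts \<alpha>))"
  show "mset ?mu = nzparts \<alpha>" by simp
  have "sorted_wrt (\<ge>) ?mu" by (simp add: sorted_wrt_rev)
  moreover have "x \<in> set ?mu \<Longrightarrow> 0 < x" for x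
    using assms by (auto simp: nzparts_def is_exponent_def)
  ultimately show "is_partition ?mu" by (simp add: is_partition_def)
qed

lemma finite_partitions: "finite {mu. is_partition mu \<and> sum_list mu = n}"
proof (rule finite_subset)
  have len: "length mu \<le> sum_list mu" if "\<forall>x\<in>set mu. 0 < x" for mu :: "nat list"
    using that by (induction mu) auto
  show "{mu. is_partition mu \<and> sum_list mu = n} \<subseteq> {mu. set mu \<subseteq> {..n} \<and> length mu \<le> n}"
    using len by (auto simp: is_partition_def intro: member_le_sum_list)
  show "finite {mu. set mu \<subseteq> {..n} \<and> length mu \<le> n}"
    by (rule finite_lists_length_le) simp
qed

section \<open>Monomial coefficients of power sum products\<close>

definition pmaps :: "nat list \<Rightarrow> (nat \<Rightarrow> nat) \<Rightarrow> (nat \<Rightarrow> nat) set" where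
  "pmaps mu \<alpha> = {\<phi>. (\<forall>i < length mu. 1 \<le> \<phi> i) \<and> (\<forall>i. length mu \<le> i \<longrightarrow> \<phi> i = 0) \<and>
      (\<forall>k. \<alpha> k = (\<Sum>i \<in> {i. i < length mu \<and> \<phi> i = k}. mu ! i))}"

lemma pcoeff_eq_card_pmaps: "pcoeff mu \<alpha> = card (pmaps mu \<alpha>)"
  by (simp add: pcoeff_def pmaps_def)

lemma pmaps_support:
  assumes "is_partition mu" "\<phi> \<in> pmaps mu \<alpha>"
  shows "{k. \<alpha> k \<noteq> 0} = \<phi> ` {..<length mu}"
proof -
  have pos: "0 < mu ! i" if "i < length mu" for i
    using assms(1) that by (simp add: is_partition_def)
  have a: "\<alpha> k = (\<Sum>i \<in> {i. i < length mu \<and> \<phi> i = k}. mu ! i)" for k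
    using assms(2) by (simp add: pmaps_def)
  show ?thesis unfolding a using pos by (auto simp: image_iff)
qed

lemma finite_pmaps:
  assumes "is_partition mu"
  shows "finite (pmaps mu \<alpha>)"
proof (cases "pmaps mu \<alpha> = {}")
  case False
  then obtain \<phi> where "\<phi> \<in> pmaps mu \<alpha>" by auto
  then have "finite {k. \<alpha> k \<noteq> 0}" using pmaps_support[OF assms] by simp
  then have "finite {\<phi>. \<forall>i. (i \<in> {..<length mu} \<longrightarrow> \<phi> i \<in> {k. \<alpha> k \<noteq> 0}) \<and> (i \<notin> {..<length mu} \<longrightarrow> \<phi> i = 0)}"
    by (intro finite_set_of_finite_funs) auto
  moreover have "pmaps mu \<alpha> \<subseteq> {\<phi>. \<forall>i. (i \<in> {..<length mu} \<longrightarrow> \<phi> i \<in> {k. \<alpha> k \<noteq> 0}) \<and> (i \<notin> {..<length mu} \<longrightarrow> \<phi> i = 0)}"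
  proof
    fix \<phi> assume f: "\<phi> \<in> pmaps mu \<alpha>"
    then have "\<phi> i = 0" if "\<not> i < length mu" for i using that by (simp add: pmaps_def)
    then show "\<phi> \<in> {\<phi>. \<forall>i. (i \<in> {..<length mu} \<longrightarrow> \<phi> i \<in> {k. \<alpha> k \<noteq> 0}) \<and> (i \<notin> {..<length mu} \<longrightarrow> \<phi> i = 0)}"
      using pmaps_support[OF assms f] by auto
  qed
  ultimately show ?thesis by (rule finite_subset[rotated])
qed simp

lemma pmaps_is_exponent:
  assumes "is_partition mu" "\<phi> \<in> pmaps mu \<alpha>"
  shows "is_exponent \<alpha>"
proof -
  have "0 \<notin> {k. \<alpha> k \<noteq> 0}" using pmaps_support[OF assms] assms(2) by (auto simp: pmaps_def)
  then show ?thesis using pmaps_support[OF assms] by (simp add: is_exponent_def)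
qed

lemma pmaps_sum:
  assumes "is_partition mu" "\<phi> \<in> pmaps mu \<alpha>"
  shows "(\<Sum>k | \<alpha> k \<noteq> 0. \<alpha> k) = sum_list mu"
proof -
  have a: "\<alpha> k = (\<Sum>i \<in> {i\<in>{..<length mu}. \<phi> i = k}. mu ! i)" for k
    using assms(2) by (simp add: pmaps_def)
  have "(\<Sum>k | \<alpha> k \<noteq> 0. \<alpha> k) = (\<Sum>k\<in>\<phi> ` {..<length mu}. \<Sum>i \<in> {i\<in>{..<length mu}. \<phi> i = k}. mu ! i)"
    unfolding pmaps_support[OF assms] by (intro sum.cong refl a)
  also have "\<dots> = (\<Sum>i<length mu. mu ! i)" by (rule sum.image_gen[symmetric]) simp
  finally show ?thesis by (simp add: sum_list_sum_nth atLeast0LessThan)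
qed

text \<open>Triangularity of power sums against monomials: sending several parts to one variable
  shortens the support, so a support of full size means that no parts were merged.\<close>

lemma pmaps_card_support:
  assumes "is_partition mu" "\<phi> \<in> pmaps mu \<alpha>"
  shows "card {k. \<alpha> k \<noteq> 0} \<le> length mu"
    and "card {k. \<alpha> k \<noteq> 0} = length mu \<Longrightarrow> nzparts \<alpha> = mset mu"
proof -
  note sup = pmaps_support[OF assms]
  show "card {k. \<alpha> k \<noteq> 0} \<le> length mu" unfolding sup using card_image_le[of "{..<length mu}" \<phi>] by simp
  assume "card {k. \<alpha> k \<noteq> 0} = length mu"
  then have inj: "inj_on \<phi> {..<length mu}" unfolding sup by (intro eq_card_imp_inj_on) auto
  have "\<alpha> (\<phi> i) = mu ! i" if "i < length mu" for i
  proof -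
    have "{j. j < length mu \<and> \<phi> j = \<phi> i} = {i}" using inj that by (auto simp: inj_on_def)
    then show ?thesis using assms(2) by (simp add: pmaps_def)
  qed
  then have "image_mset (\<alpha> \<circ> \<phi>) (mset_set {..<length mu}) = image_mset ((!) mu) (mset_set {..<length mu})"
    by (intro image_mset_cong) auto
  then show "nzparts \<alpha> = mset mu"
    unfolding nzparts_def sup using inj
    by (simp add: image_mset_mset_set[symmetric] multiset.map_comp mset_eq_image_nth)
qed

text \<open>The diagonal of the triangular system. The choice sending each part to its own variable
  is counted, so in characteristic 0 one may divide by this coefficient.\<close>

lemma pcoeff_pvec_pos:
  assumes "is_partition mu"
  shows "0 < pcoeff mu (pvec mu)"
proof -
  have "(\<lambda>i. if i < length mu then Suc i else 0) \<in> pmaps mu (pvec mu)"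
  proof -
    have "pvec mu k = (\<Sum>i | i < length mu \<and> (if i < length mu then Suc i else 0) = k. mu ! i)" for k
    proof (cases "1 \<le> k \<and> k \<le> length mu")
      case True
      then have "{i. i < length mu \<and> (if i < length mu then Suc i else 0) = k} = {k - 1}" by auto
      then show ?thesis using True by (simp add: pvec_def)
    next
      case False
      then have "{i. i < length mu \<and> (if i < length mu then Suc i else 0) = k} = {}" by auto
      then show ?thesis using False by (simp only: pvec_def) simp
    qed
    then show ?thesis by (simp add: pmaps_def)
  qed
  then show ?thesis using finite_pmaps[OF assms] by (auto simp: pcoeff_eq_card_pmaps card_gt_0_iff)
qed

text \<open>Renaming the chosen variables is a bijection of the counted maps; the transposition
  fixes 0 and so respects their default value.\<close>

lemma adj_symmetric_pcoeff: "adj_symmetric (pcoeff mu)"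
  unfolding adj_symmetric_def
proof (intro allI impI)
  fix \<alpha> and k :: nat
  assume k: "1 \<le> k"
  define s where "s = transpose k (Suc k)"
  have ss: "s (s x) = x" for x by (simp add: s_def)
  have s0: "s 0 = 0" using k by (simp add: s_def transpose_def)
  have s1: "1 \<le> s x" if "1 \<le> x" for x using that k by (auto simp: s_def transpose_def)
  have map: "s \<circ> \<phi> \<in> pmaps mu (\<alpha> \<circ> s)" if "\<phi> \<in> pmaps mu \<alpha>" for \<phi> and \<alpha> :: "nat \<Rightarrow> nat"
  proof -
    have "(s (\<phi> i) = x) = (\<phi> i = s x)" for i x using ss by metis
    then show ?thesis using that s0 s1 by (simp add: pmaps_def)
  qed
  have "bij_betw (\<lambda>\<phi>. s \<circ> \<phi>) (pmaps mu (\<alpha> \<circ> s)) (pmaps mu \<alpha>)"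
  proof (rule bij_betwI[where g = "\<lambda>\<phi>. s \<circ> \<phi>"])
    show "(\<circ>) s \<in> pmaps mu (\<alpha> \<circ> s) \<rightarrow> pmaps mu \<alpha>"
      using map[of _ "\<alpha> \<circ> s"] ss by (auto simp: comp_def)
    show "(\<circ>) s \<in> pmaps mu \<alpha> \<rightarrow> pmaps mu (\<alpha> \<circ> s)" using map by auto
  qed (auto simp: fun_eq_iff ss)
  then show "pcoeff mu (\<alpha> \<circ> transpose k (Suc k)) = pcoeff mu \<alpha>"
    unfolding pcoeff_eq_card_pmaps s_def by (rule bij_betw_same_card)
qed

text \<open>Power sums span: the values on exponents of maximal length are matched by the
  power sums of that length, which leaves a function supported on shorter exponents.\<close>

lemma power_sum_expansion_aux:
  fixes F :: "(nat \<Rightarrow> nat) \<Rightarrow> 'a::field_char_0"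
  assumes "adj_symmetric F"
    and "\<forall>\<alpha>. F \<alpha> \<noteq> 0 \<longrightarrow> is_exponent \<alpha> \<and> (\<Sum>k | \<alpha> k \<noteq> 0. \<alpha> k) = n \<and> card {k. \<alpha> k \<noteq> 0} \<le> m"
  shows "\<exists>a. \<forall>\<alpha>. F \<alpha> = (\<Sum>mu | is_partition mu \<and> sum_list mu = n \<and> length mu \<le> m. a mu * of_nat (pcoeff mu \<alpha>))"
  using assms
proof (induction m arbitrary: F)
  case 0
  define M where "M = {mu. is_partition mu \<and> sum_list mu = n \<and> length mu \<le> 0}"
  show ?case
  \<comment> \<open>Only the empty partition has length 0. Its power sum is the constant 1, which
    has the required degree only for \<open>n = 0\<close>.\<close>
  proof (cases "n = 0")
    case True
    then have M: "M = {[]}" by (auto simp: M_def is_partition_def)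
    have z: "F \<alpha> = 0 \<and> pcoeff [] \<alpha> = 0" if "\<alpha> \<noteq> (\<lambda>_. 0)" for \<alpha>
    proof
      show "F \<alpha> = 0" using 0(2) that by (auto simp: is_exponent_def fun_eq_iff)
      have "pmaps [] \<alpha> = {}" using that by (auto simp: pmaps_def)
      then show "pcoeff [] \<alpha> = 0" by (simp add: pcoeff_eq_card_pmaps)
    qed
    have "pmaps [] (\<lambda>_. 0) = {\<lambda>_. 0}" by (auto simp: pmaps_def)
    then have one: "pcoeff [] (\<lambda>_. 0) = 1" by (simp add: pcoeff_eq_card_pmaps)
    have e: "F \<alpha> = F (\<lambda>_. 0) * of_nat (pcoeff [] \<alpha>)" for \<alpha>
      using z one by (cases "\<alpha> = (\<lambda>_. 0)") auto
    have "\<forall>\<alpha>. F \<alpha> = (\<Sum>mu\<in>M. F (\<lambda>_. 0) * of_nat (pcoeff mu \<alpha>))"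
      unfolding M by (simp add: e[symmetric])
    then show ?thesis unfolding M_def by (intro exI[of _ "\<lambda>_. F (\<lambda>_. 0)"])
  next
    case False
    have "F \<alpha> = 0" for \<alpha>
    proof (rule ccontr)
      assume "F \<alpha> \<noteq> 0"
      with 0(2) have E: "is_exponent \<alpha>" "(\<Sum>k | \<alpha> k \<noteq> 0. \<alpha> k) = n" "card {k. \<alpha> k \<noteq> 0} = 0" by auto
      then have "{k. \<alpha> k \<noteq> 0} = {}" by (simp add: is_exponent_def)
      then show False using E(2) False by (metis sum.empty)
    qed
    then show ?thesis by (intro exI[of _ "\<lambda>_. 0"]) simp
  qed
next
  case (Suc m)
  define M where "M = (\<lambda>m. {mu. is_partition mu \<and> sum_list mu = n \<and> length mu \<le> m})"
  define N where "N = {mu. is_partition mu \<and> sum_list mu = n \<and> length mu = Suc m}"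
  have fin: "finite (M m)" "finite N"
    by (auto intro: finite_subset[OF _ finite_partitions[of n]] simp: M_def N_def)
  have MN: "M (Suc m) = M m \<union> N" "M m \<inter> N = {}" by (auto simp: M_def N_def)
  \<comment> \<open>Dividing by the diagonal coefficient makes the correction agree with
    \<open>F\<close> at \<open>pvec mu\<close>.\<close>
  define b where "b = (\<lambda>mu. F (pvec mu) / of_nat (pcoeff mu (pvec mu)))"
  define G where "G = (\<lambda>\<alpha>. F \<alpha> - (\<Sum>mu\<in>N. b mu * of_nat (pcoeff mu \<alpha>)))"
  have symG: "adj_symmetric G"
    using Suc.prems(1) adj_symmetric_pcoeff by (simp add: adj_symmetric_def G_def)
  have pc0: "pcoeff mu \<alpha> = 0" if "mu \<in> N" "\<not> (is_exponent \<alpha> \<and> (\<Sum>k | \<alpha> k \<noteq> 0. \<alpha> k) = n \<and> card {k. \<alpha> k \<noteq> 0} \<le> Suc m)" for mu \<alpha>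
  proof -
    have "\<phi> \<notin> pmaps mu \<alpha>" for \<phi>
    proof
      assume f: "\<phi> \<in> pmaps mu \<alpha>"
      have mu: "is_partition mu" "sum_list mu = n" "length mu = Suc m" using that(1) by (simp_all add: N_def)
      show False using that(2) pmaps_is_exponent[OF mu(1) f] pmaps_sum[OF mu(1) f]
        pmaps_card_support(1)[OF mu(1) f] mu by simp
    qed
    then have "pmaps mu \<alpha> = {}" by blast
    then show ?thesis by (simp add: pcoeff_eq_card_pmaps)
  qed
  have suppG: "is_exponent \<alpha> \<and> (\<Sum>k | \<alpha> k \<noteq> 0. \<alpha> k) = n \<and> card {k. \<alpha> k \<noteq> 0} \<le> m" if "G \<alpha> \<noteq> 0" for \<alpha>
  proof -
    have E: "is_exponent \<alpha> \<and> (\<Sum>k | \<alpha> k \<noteq> 0. \<alpha> k) = n \<and> card {k. \<alpha> k \<noteq> 0} \<le> Suc m"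
    proof (rule ccontr)
      assume *: "\<not> ?thesis"
      then have "F \<alpha> = 0" using Suc.prems(2) by blast
      moreover have "(\<Sum>mu\<in>N. b mu * of_nat (pcoeff mu \<alpha>)) = 0"
        using pc0 * by (intro sum.neutral) simp
      ultimately show False using that by (simp add: G_def)
    qed
    have "card {k. \<alpha> k \<noteq> 0} \<noteq> Suc m"
    proof
      assume card: "card {k. \<alpha> k \<noteq> 0} = Suc m"
      obtain nu where nu: "is_partition nu" "mset nu = nzparts \<alpha>"
        using ex_partition_nzparts E by blast
      have "length nu = Suc m" using arg_cong[OF nu(2), of size] card by (simp add: nzparts_def)
      moreover have "sum_list nu = n"
        using arg_cong[OF nu(2), of sum_mset] E by (simp add: nzparts_def sum_mset_sum_list sum_unfold_sum_mset)
      ultimately have nuN: "nu \<in> N" using nu by (simp add: N_def)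
      have eqv: "nzparts \<alpha> = nzparts (pvec nu)" using nu nzparts_pvec by simp
      have "F \<alpha> = F (pvec nu)"
        using adj_symmetric_nzparts[OF Suc.prems(1)] E is_exponent_pvec nu(1) eqv by blast
      moreover have pn: "pcoeff nu \<alpha> = pcoeff nu (pvec nu)"
        using adj_symmetric_nzparts[OF adj_symmetric_pcoeff] E is_exponent_pvec nu(1) eqv by blast
      \<comment> \<open>Among the partitions in \<open>N\<close> only \<open>nu\<close> contributes
        at \<open>\<alpha>\<close>, by the equality case of
        \<open>pmaps_card_support\<close>.\<close>
      moreover have "pcoeff mu \<alpha> = 0" if "mu \<in> N" "mu \<noteq> nu" for mu
      proof -
        have "\<phi> \<notin> pmaps mu \<alpha>" for \<phi>
        proof
          assume "\<phi> \<in> pmaps mu \<alpha>"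
          then have "nzparts \<alpha> = mset mu" using pmaps_card_support(2) that(1) card by (simp add: N_def)
          then show False using is_partition_mset_eq[of mu nu] nu that by (simp add: N_def)
        qed
        then have "pmaps mu \<alpha> = {}" by auto
        then show ?thesis by (simp add: pcoeff_eq_card_pmaps)
      qed
      then have "(\<Sum>mu\<in>N. b mu * of_nat (pcoeff mu \<alpha>)) = b nu * of_nat (pcoeff nu \<alpha>)"
        using fin nuN by (subst sum.remove[of _ nu]) (auto intro!: sum.neutral)
      moreover have "(of_nat (pcoeff nu (pvec nu)) :: 'a) \<noteq> 0" using pcoeff_pvec_pos[OF nu(1)] by simp
      ultimately have "G \<alpha> = 0" by (simp add: G_def b_def)
      then show False using that by simp
    qed
    then show ?thesis using E by simp
  qed
  obtain a where a: "\<forall>\<alpha>. G \<alpha> = (\<Sum>mu\<in>M m. a mu * of_nat (pcoeff mu \<alpha>))"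
    using Suc.IH[OF symG] suppG unfolding M_def by blast
  have "F \<alpha> = (\<Sum>mu\<in>M (Suc m). (if mu \<in> N then b mu else a mu) * of_nat (pcoeff mu \<alpha>))" for \<alpha>
  proof -
    have "(\<Sum>mu\<in>M (Suc m). (if mu \<in> N then b mu else a mu) * of_nat (pcoeff mu \<alpha>))
      = (\<Sum>mu\<in>M m. (if mu \<in> N then b mu else a mu) * of_nat (pcoeff mu \<alpha>)) +
        (\<Sum>mu\<in>N. (if mu \<in> N then b mu else a mu) * of_nat (pcoeff mu \<alpha>))"
      unfolding MN(1) using fin MN(2) by (rule sum.union_disjoint)
    also have "(\<Sum>mu\<in>M m. (if mu \<in> N then b mu else a mu) * of_nat (pcoeff mu \<alpha>)) = G \<alpha>"
      using a MN(2) by (auto intro!: sum.cong)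
    finally show ?thesis by (simp add: G_def)
  qed
  then show ?case unfolding M_def by (intro exI[of _ "\<lambda>mu. if mu \<in> N then b mu else a mu"] allI)
qed

lemma power_sum_expansion:
  fixes F :: "(nat \<Rightarrow> nat) \<Rightarrow> 'a::field_char_0"
  assumes "adj_symmetric F"
    and "\<forall>\<alpha>. F \<alpha> \<noteq> 0 \<longrightarrow> is_exponent \<alpha> \<and> (\<Sum>k | \<alpha> k \<noteq> 0. \<alpha> k) = n"
  obtains a where "finite {mu. a mu \<noteq> 0}" "\<forall>mu. a mu \<noteq> 0 \<longrightarrow> is_partition mu"
    "\<forall>\<alpha>. F \<alpha> = (\<Sum>mu | a mu \<noteq> 0. a mu * of_nat (pcoeff mu \<alpha>))"
proof -
  define M where "M = {mu. is_partition mu \<and> sum_list mu = n \<and> length mu \<le> n}"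
  have finM: "finite M" by (auto intro: finite_subset[OF _ finite_partitions[of n]] simp: M_def)
  \<comment> \<open>Each occurring variable has exponent at least 1, so the degree \<open>n\<close>
    also serves as the bound on the length.\<close>
  have "card {k. \<alpha> k \<noteq> 0} \<le> (\<Sum>k | \<alpha> k \<noteq> 0. \<alpha> k)" for \<alpha> :: "nat \<Rightarrow> nat"
    unfolding card_eq_sum by (intro sum_mono) auto
  then have "\<forall>\<alpha>. F \<alpha> \<noteq> 0 \<longrightarrow> is_exponent \<alpha> \<and> (\<Sum>k | \<alpha> k \<noteq> 0. \<alpha> k) = n \<and> card {k. \<alpha> k \<noteq> 0} \<le> n"
    using assms(2) by metis
  then obtain a where a: "\<forall>\<alpha>. F \<alpha> = (\<Sum>mu\<in>M. a mu * of_nat (pcoeff mu \<alpha>))"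
    using power_sum_expansion_aux[OF assms(1)] unfolding M_def by blast
  \<comment> \<open>The plethysm sums over the support of the coefficient function, so the
    coefficients must vanish outside \<open>M\<close>.\<close>
  define a' where "a' = (\<lambda>mu. if mu \<in> M then a mu else 0)"
  have "F \<alpha> = (\<Sum>mu | a' mu \<noteq> 0. a' mu * of_nat (pcoeff mu \<alpha>))" for \<alpha>
  proof -
    have "F \<alpha> = (\<Sum>mu\<in>M. a' mu * of_nat (pcoeff mu \<alpha>))" using a by (simp add: a'_def)
    also have "\<dots> = (\<Sum>mu | a' mu \<noteq> 0. a' mu * of_nat (pcoeff mu \<alpha>))"
      using finM by (intro sum.mono_neutral_right) (auto simp: a'_def)
    finally show ?thesis .
  qed
  moreover have "finite {mu. a' mu \<noteq> 0}" using finM by (rule finite_subset[rotated]) (auto simp: a'_def)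
  moreover have "\<forall>mu. a' mu \<noteq> 0 \<longrightarrow> is_partition mu" by (auto simp: a'_def M_def)
  ultimately show ?thesis using that by blast
qed

section \<open>Superization\<close>

definition fills :: "'b set \<Rightarrow> ('b \<Rightarrow> letter) set" where
  "fills J = {\<sigma>. (\<forall>u\<in>J. 1 \<le> fst (\<sigma> u)) \<and> (\<forall>u. u \<notin> J \<longrightarrow> \<sigma> u = zero_letter)}"

definition lcont :: "'b set \<Rightarrow> ('b \<Rightarrow> nat) \<Rightarrow> ('b \<Rightarrow> letter) \<Rightarrow> letter \<Rightarrow> nat" where
  "lcont J m \<sigma> l = (\<Sum>u\<in>{u\<in>J. \<sigma> u = l}. m u)"

definition acont :: "'b set \<Rightarrow> ('b \<Rightarrow> nat) \<Rightarrow> ('b \<Rightarrow> letter) \<Rightarrow> nat \<Rightarrow> nat" where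
  "acont J m \<sigma> k = (\<Sum>u\<in>{u\<in>J. fst (\<sigma> u) = k}. m u)"

text \<open>A coefficient of the difference of two alphabets, positive minus negative letters. Cells
  with \<open>m = 1\<close> give the series of a diagram; positions of parts with \<open>m\<close>
  the parts give a product of power sums. The sign counts entries and not their weights, as
  \<open>p_n\<close> of a difference is the difference of the \<open>p_n\<close>.\<close>

definition super_sum :: "'b set \<Rightarrow> ('b \<Rightarrow> nat) \<Rightarrow> (('b \<Rightarrow> letter) \<Rightarrow> 'a::comm_ring_1) \<Rightarrow> (letter \<Rightarrow> nat) \<Rightarrow> 'a" where
  "super_sum J m W \<kappa> = (\<Sum>\<sigma> | \<sigma> \<in> fills J \<and> lcont J m \<sigma> = \<kappa>. (-1) ^ card {u\<in>J. snd (\<sigma> u)} * W \<sigma>)"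

text \<open>The specialisation to \<open>X(t - 1)\<close>: a positive letter \<open>k\<close>
  becomes \<open>t x_k\<close>, a negative one becomes \<open>x_k\<close>. An index of weight
  \<open>m u\<close> therefore carries the power \<open>m u\<close> of \<open>t\<close>.\<close>

definition full_sum :: "'b set \<Rightarrow> ('b \<Rightarrow> nat) \<Rightarrow> (('b \<Rightarrow> letter) \<Rightarrow> 'a::comm_ring_1) \<Rightarrow> 'a \<Rightarrow> (nat \<Rightarrow> nat) \<Rightarrow> 'a" where
  "full_sum J m W t \<alpha> = (\<Sum>\<sigma> | \<sigma> \<in> fills J \<and> acont J m \<sigma> = \<alpha>.
     (-1) ^ card {u\<in>J. snd (\<sigma> u)} * t ^ (\<Sum>u\<in>{u\<in>J. \<not> snd (\<sigma> u)}. m u) * W \<sigma>)"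

definition toggle :: "'b \<Rightarrow> ('b \<Rightarrow> letter) \<Rightarrow> 'b \<Rightarrow> letter" where
  "toggle p \<sigma> = \<sigma>(p := (fst (\<sigma> p), \<not> snd (\<sigma> p)))"

text \<open>Splitting at \<open>k\<close> moves the negative letter of absolute value \<open>k\<close> and all larger letters up by one,
  which leaves an unused positive letter directly below that negative letter.\<close>

definition split_letter :: "nat \<Rightarrow> letter \<Rightarrow> letter" where
  "split_letter k l = (if rank1 l \<le> 2 * k then l else (Suc (fst l), snd l))"

definition unsplit_letter :: "nat \<Rightarrow> letter \<Rightarrow> letter" where
  "unsplit_letter k l = (if fst l \<le> k then l else (fst l - 1, snd l))"

text \<open>The exponents after splitting; the two letters given exponent 0 are exactly those missed
  by \<open>split_letter k\<close>.\<close>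

definition split_cont :: "nat \<Rightarrow> (letter \<Rightarrow> nat) \<Rightarrow> letter \<Rightarrow> nat" where
  "split_cont k \<kappa> l = (if l = (k, True) \<or> l = (Suc k, False) then 0 else \<kappa> (unsplit_letter k l))"

lemma unsplit_split: "unsplit_letter k (split_letter k l) = l"
  by (cases l) (auto simp: unsplit_letter_def split_letter_def rank1_def)

lemma split_unsplit: "l \<noteq> (k, True) \<Longrightarrow> l \<noteq> (Suc k, False) \<Longrightarrow> split_letter k (unsplit_letter k l) = l"
  by (cases l) (auto simp: unsplit_letter_def split_letter_def rank1_def)

lemma split_letter_neq: "split_letter k l \<noteq> (k, True)" "split_letter k l \<noteq> (Suc k, False)"
  by (cases l; auto simp: split_letter_def rank1_def split: if_splits)+

lemma snd_split_letter: "snd (split_letter k l) = snd l" "snd (unsplit_letter k l) = snd l"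
  by (auto simp: split_letter_def unsplit_letter_def)

lemma split_cont_split: "split_cont k \<kappa> (split_letter k l) = \<kappa> l"
  by (simp add: split_cont_def split_letter_neq unsplit_split)

lemma fst_toggle [simp]: "fst (toggle p \<sigma> u) = fst (\<sigma> u)"
  by (simp add: toggle_def)

lemma toggle_toggle [simp]: "toggle p (toggle p \<sigma>) = \<sigma>"
  by (simp add: toggle_def)

lemma toggle_in_fills: "\<sigma> \<in> fills J \<Longrightarrow> p \<in> J \<Longrightarrow> toggle p \<sigma> \<in> fills J"
  by (auto simp: fills_def toggle_def)

lemma sign_toggle:
  assumes "finite J" "p \<in> J"
  shows "(-1 :: 'a::comm_ring_1) ^ card {u\<in>J. snd (toggle p \<sigma> u)} = - ((-1) ^ card {u\<in>J. snd (\<sigma> u)})"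
proof (cases "snd (\<sigma> p)")
  case True
  have "{u\<in>J. snd (\<sigma> u)} = insert p {u\<in>J. snd (toggle p \<sigma> u)}" "p \<notin> {u\<in>J. snd (toggle p \<sigma> u)}"
    using True assms by (auto simp: toggle_def)
  then show ?thesis using assms by simp
next
  case False
  have "{u\<in>J. snd (toggle p \<sigma> u)} = insert p {u\<in>J. snd (\<sigma> u)}" "p \<notin> {u\<in>J. snd (\<sigma> u)}"
    using False assms by (auto simp: toggle_def)
  then show ?thesis using assms by simp
qed

lemma acont_toggle: "acont J m (toggle p \<sigma>) = acont J m \<sigma>"
  by (simp add: acont_def fun_eq_iff)

lemma acont_eq_lcont:
  assumes "finite J"
  shows "acont J m \<sigma> k = lcont J m \<sigma> (k, False) + lcont J m \<sigma> (k, True)"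
proof -
  have "{u\<in>J. fst (\<sigma> u) = k} = {u\<in>J. \<sigma> u = (k, False)} \<union> {u\<in>J. \<sigma> u = (k, True)}"
    by (auto simp: prod_eq_iff)
  then show ?thesis unfolding acont_def lcont_def using assms
    by (simp add: sum.union_disjoint disjoint_iff)
qed

text \<open>The sum equals its own negative, and 2 is invertible in characteristic 0.\<close>

lemma sum_sign_reversing:
  fixes f :: "'b \<Rightarrow> 'a::field_char_0"
  assumes "\<And>x. x \<in> B \<Longrightarrow> h x \<in> B" "\<And>x. x \<in> B \<Longrightarrow> h (h x) = x" "\<And>x. x \<in> B \<Longrightarrow> f (h x) = - f x"
  shows "sum f B = 0"
proof -
  have "sum f B = (\<Sum>x\<in>B. - f x)"
    by (rule sum.reindex_bij_witness[of _ h h]) (use assms in auto)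
  then have "2 * sum f B = 0" by (simp add: sum_negf)
  then show ?thesis by simp
qed

lemma finite_fills_image:
  assumes "finite J" "finite L"
  shows "finite {\<sigma> \<in> fills J. \<forall>u\<in>J. \<sigma> u \<in> L}"
proof (rule finite_subset)
  show "finite {\<sigma>. \<forall>u. (u \<in> J \<longrightarrow> \<sigma> u \<in> L) \<and> (u \<notin> J \<longrightarrow> \<sigma> u = zero_letter)}"
    using assms by (rule finite_set_of_finite_funs)
qed (auto simp: fills_def)

text \<open>Since \<open>m\<close> is positive, every absolute value used by the filling lies in the
  support of \<open>\<alpha>\<close>.\<close>

lemma finite_fills_acont:
  assumes "finite J" "\<And>u. u \<in> J \<Longrightarrow> 0 < m u"
  shows "finite {\<sigma> \<in> fills J. acont J m \<sigma> = \<alpha>}"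
proof -
  have pos: "0 < acont J m \<sigma> (fst (\<sigma> u))" if "u \<in> J" for \<sigma> u
    using that assms unfolding acont_def by (intro sum_pos) auto
  have supp: "{k. acont J m \<sigma> k \<noteq> 0} \<subseteq> (\<lambda>u. fst (\<sigma> u)) ` J" for \<sigma>
  proof
    fix k assume "k \<in> {k. acont J m \<sigma> k \<noteq> 0}"
    then have "{u\<in>J. fst (\<sigma> u) = k} \<noteq> {}" unfolding acont_def by (metis (mono_tags) mem_Collect_eq sum.empty)
    then show "k \<in> (\<lambda>u. fst (\<sigma> u)) ` J" by auto
  qed
  show ?thesis
  proof (cases "finite {k. \<alpha> k \<noteq> 0}")
    case True
    have "{\<sigma> \<in> fills J. acont J m \<sigma> = \<alpha>} \<subseteq> {\<sigma> \<in> fills J. \<forall>u\<in>J. \<sigma> u \<in> {k. \<alpha> k \<noteq> 0} \<times> UNIV}"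
      using pos by (fastforce simp: mem_Times_iff)
    then show ?thesis using finite_fills_image[OF assms(1), of "{k. \<alpha> k \<noteq> 0} \<times> UNIV"] True
      by (auto intro: finite_subset)
  next
    case False
    then have "{\<sigma> \<in> fills J. acont J m \<sigma> = \<alpha>} = {}"
      using supp assms(1) by (auto dest: finite_subset)
    then show ?thesis by (metis finite.emptyI)
  qed
qed

lemma finite_fills_lcont:
  assumes "finite J" "\<And>u. u \<in> J \<Longrightarrow> 0 < m u"
  shows "finite {\<sigma> \<in> fills J. lcont J m \<sigma> = \<kappa>}"
proof (rule finite_subset)
  show "{\<sigma> \<in> fills J. lcont J m \<sigma> = \<kappa>} \<subseteq> {\<sigma> \<in> fills J. acont J m \<sigma> = (\<lambda>k. \<kappa> (k, False) + \<kappa> (k, True))}"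
    using acont_eq_lcont[OF assms(1)] by auto
qed (rule finite_fills_acont[OF assms])

text \<open>\<open>W_split\<close> holds for weights that see letters only through their order. The
  cell to toggle is chosen from the set of cells of absolute value \<open>k\<close>; toggling
  preserves this set, so it is an involution. The choice is a parameter because the diagram requires
  the last such cell, while a constant weight allows any.\<close>

locale superization =
  fixes J :: "'b set" and m :: "'b \<Rightarrow> nat" and W :: "('b \<Rightarrow> letter) \<Rightarrow> 'a::field_char_0"
    and pick :: "'b set \<Rightarrow> 'b"
  assumes fin: "finite J" and mpos: "\<And>u. u \<in> J \<Longrightarrow> 0 < m u"
    and pick: "\<And>A. A \<subseteq> J \<Longrightarrow> A \<noteq> {} \<Longrightarrow> pick A \<in> A"
    and W_split: "\<And>\<sigma> k. \<sigma> \<in> fills J \<Longrightarrow> 1 \<le> k \<Longrightarrow> W (split_letter k \<circ> \<sigma>) = W \<sigma>"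
    and W_toggle: "\<And>\<sigma> k. \<sigma> \<in> fills J \<Longrightarrow> 1 \<le> k \<Longrightarrow> {u\<in>J. fst (\<sigma> u) = k} \<noteq> {} \<Longrightarrow>
       W (toggle (pick {u\<in>J. fst (\<sigma> u) = k}) \<sigma>) = W \<sigma>"
begin

text \<open>Splitting is a bijection onto the fillings of the split content: as \<open>m\<close> is
  positive, such a filling cannot use the two vacated letters and can be unsplit.\<close>

lemma super_sum_split:
  assumes k: "1 \<le> k"
  shows "super_sum J m W (split_cont k \<kappa>) = super_sum J m W \<kappa>"
proof -
  have z: "split_letter k zero_letter = zero_letter" "unsplit_letter k zero_letter = zero_letter"
    by (simp_all add: split_letter_def unsplit_letter_def zero_letter_def rank1_def)
  have avoid: "\<tau> u \<noteq> (k, True) \<and> \<tau> u \<noteq> (Suc k, False)"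
    if "lcont J m \<tau> = split_cont k \<kappa>" "u \<in> J" for \<tau> u
  proof -
    have "0 < lcont J m \<tau> (\<tau> u)" unfolding lcont_def using that(2) fin mpos by (intro sum_pos) auto
    then show ?thesis using that(1) by (auto simp: split_cont_def)
  qed
  show ?thesis
    unfolding super_sum_def
  proof (rule sum.reindex_bij_witness[of _ "\<lambda>\<sigma>. split_letter k \<circ> \<sigma>" "\<lambda>\<sigma>. unsplit_letter k \<circ> \<sigma>"])
    fix \<tau> assume "\<tau> \<in> {\<sigma>. \<sigma> \<in> fills J \<and> lcont J m \<sigma> = split_cont k \<kappa>}"
    then have t: "\<tau> \<in> fills J" "lcont J m \<tau> = split_cont k \<kappa>" by auto
    have inv: "split_letter k (unsplit_letter k (\<tau> u)) = \<tau> u" for u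
      using t z split_unsplit[of "\<tau> u" k] avoid[OF t(2), of u] by (cases "u \<in> J") (auto simp: fills_def)
    then show rt: "split_letter k \<circ> (unsplit_letter k \<circ> \<tau>) = \<tau>" by (simp add: fun_eq_iff)
    have "1 \<le> fst (unsplit_letter k l)" if "1 \<le> fst l" for l
      using that k by (auto simp: unsplit_letter_def)
    then have f: "unsplit_letter k \<circ> \<tau> \<in> fills J" using t(1) z by (auto simp: fills_def)
    have "lcont J m (unsplit_letter k \<circ> \<tau>) l = \<kappa> l" for l
    proof -
      have "unsplit_letter k (\<tau> u) = l \<longleftrightarrow> \<tau> u = split_letter k l" for u
        using inv[of u] unsplit_split by metis
      then have "lcont J m (unsplit_letter k \<circ> \<tau>) l = lcont J m \<tau> (split_letter k l)"
        by (simp add: lcont_def)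
      then show ?thesis using t(2) by (simp add: split_cont_split)
    qed
    then show "unsplit_letter k \<circ> \<tau> \<in> {\<sigma>. \<sigma> \<in> fills J \<and> lcont J m \<sigma> = \<kappa>}" using f by auto
    show "(- 1) ^ card {u \<in> J. snd ((unsplit_letter k \<circ> \<tau>) u)} * W (unsplit_letter k \<circ> \<tau>) =
          (- 1) ^ card {u \<in> J. snd (\<tau> u)} * W \<tau>"
      using W_split[OF f k] rt by (simp add: snd_split_letter)
  next
    fix \<sigma> assume "\<sigma> \<in> {\<sigma>. \<sigma> \<in> fills J \<and> lcont J m \<sigma> = \<kappa>}"
    then have t: "\<sigma> \<in> fills J" "lcont J m \<sigma> = \<kappa>" by auto
    show "unsplit_letter k \<circ> (split_letter k \<circ> \<sigma>) = \<sigma>" by (simp add: fun_eq_iff unsplit_split)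
    have "1 \<le> fst (split_letter k l)" if "1 \<le> fst l" for l
      using that by (auto simp: split_letter_def)
    then have f: "split_letter k \<circ> \<sigma> \<in> fills J" using t(1) z by (auto simp: fills_def)
    have "lcont J m (split_letter k \<circ> \<sigma>) l = split_cont k \<kappa> l" for l
    proof (cases "l = (k, True) \<or> l = (Suc k, False)")
      case True
      then have "{u\<in>J. (split_letter k \<circ> \<sigma>) u = l} = {}" by (auto simp: split_letter_neq)
      then have "lcont J m (split_letter k \<circ> \<sigma>) l = 0" unfolding lcont_def by (simp only: sum.empty)
      then show ?thesis using True by (simp add: split_cont_def)
    next
      case False
      then have "split_letter k (\<sigma> u) = l \<longleftrightarrow> \<sigma> u = unsplit_letter k l" for u
        using split_unsplit unsplit_split by metis
      then show ?thesis using False t(2) by (auto simp: split_cont_def lcont_def)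
    qed
    then show "split_letter k \<circ> \<sigma> \<in> {\<sigma>. \<sigma> \<in> fills J \<and> lcont J m \<sigma> = split_cont k \<kappa>}" using f by auto
  qed
qed

text \<open>Cancellation of equal variables in a difference of alphabets. Toggling moves weight
  between \<open>k\<close> and its negative and preserves only their total \<open>g\<close>, so all
  distributions are summed together; \<open>0 < g\<close> provides a cell to toggle.\<close>

lemma super_sum_cancel:
  assumes k: "1 \<le> k" and g: "0 < g"
  shows "(\<Sum>i\<le>g. super_sum J m W (\<kappa>((k, False) := i, (k, True) := g - i))) = 0"
proof -
  define f where "f = (\<lambda>\<sigma>. (-1) ^ card {u\<in>J. snd (\<sigma> u)} * W \<sigma>)"
  define B where "B = {\<sigma> \<in> fills J. (\<forall>l. fst l \<noteq> k \<longrightarrow> lcont J m \<sigma> l = \<kappa> l) \<and> acont J m \<sigma> k = g}"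
  define K where "K = (\<lambda>i. \<kappa>((k, False) := i, (k, True) := g - i))"
  have K_iff: "lcont J m \<sigma> = K i \<longleftrightarrow> (\<forall>l. fst l \<noteq> k \<longrightarrow> lcont J m \<sigma> l = \<kappa> l) \<and>
      lcont J m \<sigma> (k, False) = i \<and> lcont J m \<sigma> (k, True) = g - i" for \<sigma> i
    unfolding K_def fun_eq_iff by (auto simp: split_paired_all)
  have "(\<Sum>i\<le>g. super_sum J m W (K i)) = sum f (\<Union>i\<in>{..g}. {\<sigma> \<in> fills J. lcont J m \<sigma> = K i})"
  proof -
    have "finite {\<sigma> \<in> fills J. lcont J m \<sigma> = K i}" for i
      by (rule finite_fills_lcont[OF fin mpos])
    moreover have "{\<sigma> \<in> fills J. lcont J m \<sigma> = K i} \<inter> {\<sigma> \<in> fills J. lcont J m \<sigma> = K j} = {}" if "i \<noteq> j" for i j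
      using that by (auto simp: K_iff)
    ultimately show ?thesis
      unfolding super_sum_def f_def by (subst sum.UNION_disjoint) auto
  qed
  also have "(\<Union>i\<in>{..g}. {\<sigma> \<in> fills J. lcont J m \<sigma> = K i}) = B"
    by (auto simp: B_def K_iff acont_eq_lcont[OF fin])
  also have "sum f B = 0"
  proof (rule sum_sign_reversing)
    fix \<sigma> assume "\<sigma> \<in> B"
    then have s: "\<sigma> \<in> fills J" "\<And>l. fst l \<noteq> k \<Longrightarrow> lcont J m \<sigma> l = \<kappa> l" "acont J m \<sigma> k = g"
      by (auto simp: B_def)
    define A where "A = {u\<in>J. fst (\<sigma> u) = k}"
    have "A \<noteq> {}" using s(3) g unfolding acont_def A_def by (metis less_irrefl sum.empty)
    then have p: "pick A \<in> J" "fst (\<sigma> (pick A)) = k" using pick[of A] by (auto simp: A_def)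
    let ?h = "\<lambda>\<sigma>. toggle (pick {u\<in>J. fst (\<sigma> u) = k}) \<sigma>"
    have h: "?h \<sigma> = toggle (pick A) \<sigma>" by (simp add: A_def)
    show "?h (?h \<sigma>) = \<sigma>" by simp
    have "lcont J m (toggle (pick A) \<sigma>) l = lcont J m \<sigma> l" if "fst l \<noteq> k" for l
    proof -
      have "{u\<in>J. toggle (pick A) \<sigma> u = l} = {u\<in>J. \<sigma> u = l}" using p that by (auto simp: toggle_def)
      then show ?thesis by (simp add: lcont_def)
    qed
    then show "?h \<sigma> \<in> B" unfolding h B_def using s p(1) by (simp add: toggle_in_fills acont_toggle)
    have w: "W (toggle (pick A) \<sigma>) = W \<sigma>"
      using W_toggle[OF s(1) k] \<open>A \<noteq> {}\<close> by (simp add: A_def)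
    show "f (?h \<sigma>) = - f \<sigma>"
      unfolding h f_def w sign_toggle[OF fin p(1)] by simp
  qed
  finally show ?thesis unfolding K_def .
qed

text \<open>Fillings are grouped by signed content, and the power of \<open>t\<close> depends only
  on its positive part.\<close>

lemma full_sum_eq_super_sum:
  assumes "finite {k. \<alpha> k \<noteq> 0}"
  shows "full_sum J m W t \<alpha> = (\<Sum>\<kappa> | \<forall>k. \<kappa> (k, False) + \<kappa> (k, True) = \<alpha> k.
     t ^ (\<Sum>k | \<alpha> k \<noteq> 0. \<kappa> (k, False)) * super_sum J m W \<kappa>)"
proof -
  define S where "S = {\<sigma> \<in> fills J. acont J m \<sigma> = \<alpha>}"
  define T where "T = {\<kappa> :: letter \<Rightarrow> nat. \<forall>k. \<kappa> (k, False) + \<kappa> (k, True) = \<alpha> k}"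
  have finT: "finite T"
  proof (rule finite_subset)
    let ?N = "\<Sum>k | \<alpha> k \<noteq> 0. \<alpha> k"
    show "finite {\<kappa>. \<forall>l. (l \<in> {k. \<alpha> k \<noteq> 0} \<times> UNIV \<longrightarrow> \<kappa> l \<in> {..?N}) \<and> (l \<notin> {k. \<alpha> k \<noteq> 0} \<times> (UNIV::bool set) \<longrightarrow> \<kappa> l = 0)}"
      using assms by (intro finite_set_of_finite_funs) auto
    have le: "\<alpha> k \<le> ?N" if "\<alpha> k \<noteq> 0" for k using assms that by (intro member_le_sum) auto
    have le2: "\<kappa> (k, s) \<le> \<alpha> k" if "\<kappa> \<in> T" for \<kappa> k s
    proof -
      have "\<kappa> (k, False) + \<kappa> (k, True) = \<alpha> k" using that by (simp add: T_def)
      then show ?thesis by (cases s) simp_all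
    qed
    show "T \<subseteq> {\<kappa>. \<forall>l. (l \<in> {k. \<alpha> k \<noteq> 0} \<times> UNIV \<longrightarrow> \<kappa> l \<in> {..?N}) \<and> (l \<notin> {k. \<alpha> k \<noteq> 0} \<times> (UNIV::bool set) \<longrightarrow> \<kappa> l = 0)}"
    proof
      fix \<kappa> assume \<kappa>: "\<kappa> \<in> T"
      have "(\<alpha> k \<noteq> 0 \<longrightarrow> \<kappa> (k, s) \<le> ?N) \<and> (\<alpha> k = 0 \<longrightarrow> \<kappa> (k, s) = 0)" for k s
        using le2[OF \<kappa>, of k s] le[of k] by auto
      then show "\<kappa> \<in> {\<kappa>. \<forall>l. (l \<in> {k. \<alpha> k \<noteq> 0} \<times> UNIV \<longrightarrow> \<kappa> l \<in> {..?N}) \<and> (l \<notin> {k. \<alpha> k \<noteq> 0} \<times> (UNIV::bool set) \<longrightarrow> \<kappa> l = 0)}"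
        by auto
    qed
  qed
  have finS: "finite S" unfolding S_def by (rule finite_fills_acont[OF fin mpos])
  have img: "lcont J m ` S \<subseteq> T" using acont_eq_lcont[OF fin, of m] by (auto simp: S_def T_def)
  let ?f = "\<lambda>\<sigma>. (-1) ^ card {u\<in>J. snd (\<sigma> u)} * t ^ (\<Sum>u\<in>{u\<in>J. \<not> snd (\<sigma> u)}. m u) * W \<sigma>"
  have "full_sum J m W t \<alpha> = sum ?f S" by (simp add: full_sum_def S_def)
  also have "\<dots> = (\<Sum>\<kappa>\<in>T. \<Sum>\<sigma>\<in>{\<sigma>\<in>S. lcont J m \<sigma> = \<kappa>}. ?f \<sigma>)"
    by (rule sum.group[OF finS finT img, symmetric])
  also have "\<dots> = (\<Sum>\<kappa>\<in>T. t ^ (\<Sum>k | \<alpha> k \<noteq> 0. \<kappa> (k, False)) * super_sum J m W \<kappa>)"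
  proof (rule sum.cong[OF refl])
    fix \<kappa> assume \<kappa>: "\<kappa> \<in> T"
    have "acont J m \<sigma> = \<alpha>" if "lcont J m \<sigma> = \<kappa>" for \<sigma>
      using \<kappa> acont_eq_lcont[OF fin, of m \<sigma>] that by (auto simp: T_def)
    then have set: "{\<sigma>\<in>S. lcont J m \<sigma> = \<kappa>} = {\<sigma> \<in> fills J. lcont J m \<sigma> = \<kappa>}" by (auto simp: S_def)
    have ex: "(\<Sum>u\<in>{u\<in>J. \<not> snd (\<sigma> u)}. m u) = (\<Sum>k | \<alpha> k \<noteq> 0. \<kappa> (k, False))"
      if s: "\<sigma> \<in> S" "lcont J m \<sigma> = \<kappa>" for \<sigma>
    proof -
      define P where "P = {u\<in>J. \<not> snd (\<sigma> u)}"
      have "\<alpha> (fst (\<sigma> u)) \<noteq> 0" if "u \<in> J" for u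
      proof -
        have "0 < acont J m \<sigma> (fst (\<sigma> u))" unfolding acont_def using that fin mpos by (intro sum_pos) auto
        then show ?thesis using s by (simp add: S_def)
      qed
      then have "(\<Sum>k\<in>{k. \<alpha> k \<noteq> 0}. \<Sum>u\<in>{u\<in>P. fst (\<sigma> u) = k}. m u) = sum m P"
        using assms fin by (intro sum.group) (auto simp: P_def)
      moreover have "(\<Sum>u\<in>{u\<in>P. fst (\<sigma> u) = k}. m u) = \<kappa> (k, False)" for k
      proof -
        have "{u\<in>P. fst (\<sigma> u) = k} = {u\<in>J. \<sigma> u = (k, False)}" by (auto simp: P_def prod_eq_iff)
        then show ?thesis using s(2) by (auto simp: lcont_def)
      qed
      ultimately show ?thesis by (simp add: P_def)
    qed
    have "(\<Sum>\<sigma>\<in>{\<sigma>\<in>S. lcont J m \<sigma> = \<kappa>}. ?f \<sigma>) = (\<Sum>\<sigma>\<in>{\<sigma>\<in>S. lcont J m \<sigma> = \<kappa>}.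
       t ^ (\<Sum>k | \<alpha> k \<noteq> 0. \<kappa> (k, False)) * ((-1) ^ card {u\<in>J. snd (\<sigma> u)} * W \<sigma>))"
      by (intro sum.cong refl) (auto simp: ex)
    then show "(\<Sum>\<sigma>\<in>{\<sigma>\<in>S. lcont J m \<sigma> = \<kappa>}. ?f \<sigma>) = t ^ (\<Sum>k | \<alpha> k \<noteq> 0. \<kappa> (k, False)) * super_sum J m W \<kappa>"
      unfolding set super_sum_def by (simp add: sum_distrib_left)
  qed
  finally show ?thesis by (simp add: T_def)
qed

end

text \<open>Splitting off a negative letter and cancelling it against a new positive one
  trades negative content for positive content, so super sums are determined by
  their values on purely positive contents.\<close>

lemma zero_if_split_cancel:
  fixes D :: "(letter \<Rightarrow> nat) \<Rightarrow> 'a::ab_group_add"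
  assumes pos: "\<And>\<kappa>. (\<forall>k. \<kappa> (k, True) = 0) \<Longrightarrow> D \<kappa> = 0"
    and split: "\<And>k \<kappa>. 1 \<le> k \<Longrightarrow> D (split_cont k \<kappa>) = D \<kappa>"
    and cancel: "\<And>k g \<kappa>. 1 \<le> k \<Longrightarrow> 0 < g \<Longrightarrow> (\<Sum>i\<le>g. D (\<kappa>((k, False) := i, (k, True) := g - i))) = 0"
    and "finite {k. \<kappa> (k, True) \<noteq> 0}" "\<kappa> (0, True) = 0"
  shows "D \<kappa> = 0"
  using assms(4,5)
proof (induction "\<Sum>k | \<kappa> (k, True) \<noteq> 0. \<kappa> (k, True)" arbitrary: \<kappa> rule: less_induct)
  case less
  show ?case
  proof (cases "\<forall>k. \<kappa> (k, True) = 0")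
    case False
    then obtain k where k0: "\<kappa> (k, True) \<noteq> 0" by auto
    define c where "c = \<kappa> (k, True)"
    have k: "1 \<le> k" using k0 less.prems(2) by (cases k) auto
    define \<kappa>1 where "\<kappa>1 = split_cont k \<kappa>"
    \<comment> \<open>Splitting moves the negative letters from \<open>k\<close> on up by one;
      \<open>s\<close> is this reindexing and skips exactly the vacated index
      \<open>k\<close>.\<close>
    define s where "s = (\<lambda>x. if x < k then x else Suc x)"
    have injs: "inj s" by (auto simp: inj_def s_def split: if_splits)
    have ks: "\<kappa>1 (s x, True) = \<kappa> (x, True)" for x
    proof -
      have "(s x, True) = split_letter k (x, True)" by (auto simp: s_def split_letter_def rank1_def)
      then show ?thesis by (simp add: \<kappa>1_def split_cont_split)
    qed
    have nots: "\<kappa>1 (y, True) = 0" if "y \<notin> range s" for y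
    proof -
      have "y = k"
      proof (rule ccontr)
        assume "y \<noteq> k"
        then have "y = s (if y < k then y else y - 1)" by (auto simp: s_def)
        then show False using that by blast
      qed
      then show ?thesis by (simp add: \<kappa>1_def split_cont_def)
    qed
    define A where "A = {x. \<kappa>1 (x, True) \<noteq> 0}"
    have A: "A = s ` {x. \<kappa> (x, True) \<noteq> 0}" 
    proof (intro equalityI subsetI)
      fix y assume y: "y \<in> A"
      have "y \<in> range s"
      proof (rule ccontr)
        assume "y \<notin> range s"
        then have "\<kappa>1 (y, True) = 0" by (rule nots)
        then show False using y by (simp add: A_def)
      qed
      then obtain x where "y = s x" by blast
      then show "y \<in> s ` {x. \<kappa> (x, True) \<noteq> 0}" using y ks by (auto simp: A_def)
    qed (auto simp: A_def ks)
    have finA: "finite A" using A less.prems(1) by simp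
    have sumA: "(\<Sum>x\<in>A. \<kappa>1 (x, True)) = (\<Sum>x | \<kappa> (x, True) \<noteq> 0. \<kappa> (x, True))"
      unfolding A using injs by (subst sum.reindex) (auto simp: ks inj_on_def inj_def)
    have kc: "\<kappa>1 (Suc k, True) = c" using ks[of k] by (simp add: s_def c_def)
    have kf: "\<kappa>1 (Suc k, False) = 0" by (simp add: \<kappa>1_def split_cont_def)
    have z: "\<kappa>1 (0, True) = 0" using ks[of 0] k less.prems(2) by (simp add: s_def)
    define E where "E = (\<lambda>i. \<kappa>1((Suc k, False) := i, (Suc k, True) := c - i))"
    have E0: "E 0 = \<kappa>1" using kc kf by (auto simp: E_def)
    have "D (E i) = 0" if "i \<in> {..c} - {0}" for i
    proof (rule less.hyps)
      have sub: "{x. E i (x, True) \<noteq> 0} \<subseteq> A" using k0 kc by (auto simp: E_def A_def c_def split: if_splits)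
      then show "finite {x. E i (x, True) \<noteq> 0}" using finA by (rule finite_subset)
      show "E i (0, True) = 0" using z by (simp add: E_def)
      have "(\<Sum>x | E i (x, True) \<noteq> 0. E i (x, True)) = (\<Sum>x\<in>A. E i (x, True))"
        using sub finA by (intro sum.mono_neutral_left) auto
      also have "\<dots> < (\<Sum>x\<in>A. \<kappa>1 (x, True))"
      proof (rule sum_strict_mono_ex1[OF finA])
        show "\<forall>x\<in>A. E i (x, True) \<le> \<kappa>1 (x, True)" using kc by (auto simp: E_def)
        have "Suc k \<in> A" using kc k0 by (simp add: A_def c_def)
        moreover have "E i (Suc k, True) < \<kappa>1 (Suc k, True)" using that kc by (auto simp: E_def)
        ultimately show "\<exists>x\<in>A. E i (x, True) < \<kappa>1 (x, True)" by blast
      qed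
      finally show "(\<Sum>x | E i (x, True) \<noteq> 0. E i (x, True)) < (\<Sum>x | \<kappa> (x, True) \<noteq> 0. \<kappa> (x, True))"
        using sumA by simp
    qed
    then have "(\<Sum>i\<le>c. D (E i)) = D (E 0)"
      by (subst sum.remove[of _ 0]) auto
    moreover have "(\<Sum>i\<le>c. D (E i)) = 0"
      unfolding E_def using k0 by (intro cancel) (auto simp: c_def)
    ultimately have "D \<kappa>1 = 0" using E0 by simp
    then show ?thesis using split[OF k] by (simp add: \<kappa>1_def)
  qed (rule pos)
qed

section \<open>Power sums as signed sums\<close>

lemma superization_power_sum:
  assumes "is_partition mu"
  shows "superization {..<length mu} ((!) mu) (\<lambda>_. 1 :: 'a::field_char_0) (\<lambda>A. SOME x. x \<in> A)"
  using assms by unfold_locales (auto simp: is_partition_def some_in_eq)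

lemma super_sum_power_sum:
  assumes "is_partition mu" "\<forall>k. \<kappa> (k, True) = 0"
  shows "super_sum {..<length mu} ((!) mu) (\<lambda>_. 1) \<kappa> = (of_nat (pcoeff mu (\<lambda>k. \<kappa> (k, False))) :: 'a::comm_ring_1)"
proof -
  define L where "L = {..<length mu}"
  define S where "S = {\<sigma>. \<sigma> \<in> fills L \<and> lcont L ((!) mu) \<sigma> = \<kappa>}"
  have pos: "\<not> snd (\<sigma> u)" if "\<sigma> \<in> S" "u \<in> L" for \<sigma> u
  proof
    assume "snd (\<sigma> u)"
    then obtain k where "\<sigma> u = (k, True)" by (cases "\<sigma> u") auto
    moreover have "0 < lcont L ((!) mu) \<sigma> (\<sigma> u)"
      unfolding lcont_def using that(2) assms(1) by (intro sum_pos) (auto simp: L_def is_partition_def)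
    ultimately show False using that(1) assms(2) by (simp add: S_def)
  qed
  have z: "\<sigma> u = zero_letter" if "\<sigma> \<in> S" "u \<notin> L" for \<sigma> u using that by (simp add: S_def fills_def)
  have npos: "\<not> snd (\<sigma> u)" if "\<sigma> \<in> S" for \<sigma> u
    using pos[OF that, of u] z[OF that, of u] by (cases "u \<in> L") (auto simp: zero_letter_def)
  have set: "{u. u < length mu \<and> P u} = {u\<in>L. P u}" for P by (auto simp: L_def)
  have "bij_betw (\<lambda>\<sigma>. fst \<circ> \<sigma>) S (pmaps mu (\<lambda>k. \<kappa> (k, False)))"
  proof (rule bij_betwI[where g = "\<lambda>\<phi> i. (\<phi> i, False)"])
    show "(\<circ>) fst \<in> S \<rightarrow> pmaps mu (\<lambda>k. \<kappa> (k, False))"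
    proof
      fix \<sigma> assume s: "\<sigma> \<in> S"
      have "\<kappa> (k, False) = (\<Sum>i\<in>{i. i < length mu \<and> (fst \<circ> \<sigma>) i = k}. mu ! i)" for k
      proof -
        have eq: "{i. i < length mu \<and> (fst \<circ> \<sigma>) i = k} = {u\<in>L. \<sigma> u = (k, False)}"
          using npos[OF s] by (auto simp: L_def prod_eq_iff)
        have "\<kappa> (k, False) = lcont L ((!) mu) \<sigma> (k, False)" using s by (simp add: S_def)
        then show ?thesis unfolding lcont_def eq .
      qed
      then show "fst \<circ> \<sigma> \<in> pmaps mu (\<lambda>k. \<kappa> (k, False))"
        using s z[OF s] by (simp add: pmaps_def S_def fills_def L_def zero_letter_def)
    qed
    show "(\<lambda>\<phi> i. (\<phi> i, False)) \<in> pmaps mu (\<lambda>k. \<kappa> (k, False)) \<rightarrow> S"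
    proof
      fix \<phi> assume p: "\<phi> \<in> pmaps mu (\<lambda>k. \<kappa> (k, False))"
      have "lcont L ((!) mu) (\<lambda>i. (\<phi> i, False)) (k, s) = \<kappa> (k, s)" for k s
        using p assms(2) by (cases s) (auto simp: lcont_def pmaps_def set)
      then show "(\<lambda>i. (\<phi> i, False)) \<in> S"
        using p by (auto simp: S_def fills_def pmaps_def L_def zero_letter_def)
    qed
  qed (use npos in \<open>auto simp: fun_eq_iff prod_eq_iff\<close>)
  then have "card S = pcoeff mu (\<lambda>k. \<kappa> (k, False))"
    unfolding pcoeff_eq_card_pmaps by (rule bij_betw_same_card)
  moreover have "super_sum L ((!) mu) (\<lambda>_. 1) \<kappa> = (\<Sum>\<sigma>\<in>S. 1 :: 'a)"
    unfolding super_sum_def S_def[symmetric]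
  proof (rule sum.cong[OF refl])
    fix \<sigma> assume "\<sigma> \<in> S"
    then have "{u \<in> L. snd (\<sigma> u)} = {}" using npos by auto
    then show "(- 1) ^ card {u \<in> L. snd (\<sigma> u)} * 1 = (1 :: 'a)" by (simp only: card.empty) simp
  qed
  ultimately show ?thesis by (simp add: L_def)
qed

text \<open>A signed filling is a choice of variables together with the set \<open>N\<close> of
  parts that take a negative letter. The sum over \<open>N\<close> is the expanded product of the
  factors \<open>-1 + t ^ (mu ! i)\<close>.\<close>

lemma full_sum_power_sum:
  fixes t :: "'a::comm_ring_1"
  shows "full_sum {..<length mu} ((!) mu) (\<lambda>_. 1) t \<alpha> =
     (\<Prod>i<length mu. t ^ (mu ! i) - 1) * of_nat (pcoeff mu \<alpha>)"
proof -
  define L where "L = {..<length mu}"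
  define S where "S = {\<sigma>. \<sigma> \<in> fills L \<and> acont L ((!) mu) \<sigma> = \<alpha>}"
  define f where "f = (\<lambda>N. (-1) ^ card N * t ^ (\<Sum>u\<in>L-N. mu ! u))"
  have finL: "finite L" by (simp add: L_def)
  have "full_sum L ((!) mu) (\<lambda>_. 1) t \<alpha> = (\<Sum>(\<phi>,N)\<in>pmaps mu \<alpha> \<times> Pow L. f N)"
    unfolding full_sum_def S_def[symmetric]
  proof (rule sum.reindex_bij_witness[of _ "\<lambda>(\<phi>,N) i. (\<phi> i, i \<in> N)" "\<lambda>\<sigma>. (fst \<circ> \<sigma>, {u\<in>L. snd (\<sigma> u)})"])
    fix \<sigma> assume s: "\<sigma> \<in> S"
    have z: "\<sigma> u = zero_letter" if "u \<notin> L" for u using s that by (simp add: S_def fills_def)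
    have "\<not> snd (\<sigma> u)" if "u \<notin> L" for u using z[OF that] by (simp add: zero_letter_def)
    then show "(case (fst \<circ> \<sigma>, {u \<in> L. snd (\<sigma> u)}) of (\<phi>, N) \<Rightarrow> \<lambda>i. (\<phi> i, i \<in> N)) = \<sigma>"
      by (auto simp: fun_eq_iff prod_eq_iff)
    show "(fst \<circ> \<sigma>, {u \<in> L. snd (\<sigma> u)}) \<in> pmaps mu \<alpha> \<times> Pow L"
    proof -
      have "\<alpha> k = (\<Sum>i\<in>{i. i < length mu \<and> (fst \<circ> \<sigma>) i = k}. mu ! i)" for k
        using s by (auto simp: S_def acont_def L_def)
      then have "fst \<circ> \<sigma> \<in> pmaps mu \<alpha>"
        using s z by (simp add: pmaps_def S_def fills_def L_def zero_letter_def)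
      then show ?thesis by auto
    qed
    have "{u\<in>L. \<not> snd (\<sigma> u)} = L - {u\<in>L. snd (\<sigma> u)}" by auto
    then show "(case (fst \<circ> \<sigma>, {u \<in> L. snd (\<sigma> u)}) of (\<phi>, N) \<Rightarrow> f N) =
      (- 1) ^ card {u \<in> L. snd (\<sigma> u)} * t ^ sum ((!) mu) {u \<in> L. \<not> snd (\<sigma> u)} * 1"
      by (simp add: f_def)
  next
    fix x assume "x \<in> pmaps mu \<alpha> \<times> Pow L"
    then obtain \<phi> N where x: "x = (\<phi>, N)" "\<phi> \<in> pmaps mu \<alpha>" "N \<subseteq> L" by auto
    then show "(fst \<circ> (case x of (\<phi>, N) \<Rightarrow> \<lambda>i. (\<phi> i, i \<in> N)), {u \<in> L. snd ((case x of (\<phi>, N) \<Rightarrow> \<lambda>i. (\<phi> i, i \<in> N)) u)}) = x"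
      by auto
    show "(case x of (\<phi>, N) \<Rightarrow> \<lambda>i. (\<phi> i, i \<in> N)) \<in> S"
      using x by (auto simp: S_def fills_def pmaps_def acont_def L_def zero_letter_def fun_eq_iff)
  qed
  also have "\<dots> = (\<Sum>\<phi>\<in>pmaps mu \<alpha>. \<Sum>N\<in>Pow L. f N)" by (simp only: sum.cartesian_product)
  also have "(\<Sum>N\<in>Pow L. f N) = (\<Prod>i\<in>L. (-1) + t ^ (mu ! i))"
    unfolding prod_add[OF finL] f_def by (simp add: power_sum)
  finally show ?thesis by (simp add: pcoeff_eq_card_pmaps L_def mult.commute)
qed

text \<open>Splitting and cancellation are linear laws, so they pass to the difference
  \<open>D\<close> of the two sides at the level of signed contents. \<open>D\<close> vanishes on
  positive contents by \<open>base\<close>, hence at every signed content that contributes to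
  \<open>\<alpha>\<close>.\<close>

theorem full_sum_power_sum_expansion:
  fixes W :: "('b \<Rightarrow> letter) \<Rightarrow> 'a::field_char_0"
  assumes sup: "superization J m W pick" and M: "finite M" "\<forall>mu\<in>M. is_partition mu"
    and base: "\<And>\<kappa>. (\<forall>k. \<kappa> (k, True) = 0) \<Longrightarrow>
      super_sum J m W \<kappa> = (\<Sum>mu\<in>M. a mu * of_nat (pcoeff mu (\<lambda>k. \<kappa> (k, False))))"
    and \<alpha>: "is_exponent \<alpha>"
  shows "full_sum J m W t \<alpha> =
    (\<Sum>mu\<in>M. a mu * (\<Prod>i<length mu. t ^ (mu ! i) - 1) * of_nat (pcoeff mu \<alpha>))"
proof -
  define P where "P = (\<lambda>mu. super_sum {..<length mu} ((!) mu) (\<lambda>_. 1 :: 'a))"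
  define D where "D = (\<lambda>\<kappa>. super_sum J m W \<kappa> - (\<Sum>mu\<in>M. a mu * P mu \<kappa>))"
  have psup: "superization {..<length mu} ((!) mu) (\<lambda>_. 1 :: 'a) (\<lambda>A. SOME x. x \<in> A)" if "mu \<in> M" for mu
    using superization_power_sum M(2) that by blast
  have D0: "D \<kappa> = 0" if \<kappa>: "\<forall>k. \<kappa> (k, False) + \<kappa> (k, True) = \<alpha> k" for \<kappa>
  proof (rule zero_if_split_cancel[of D])
    show "D \<kappa> = 0" if "\<forall>k. \<kappa> (k, True) = 0" for \<kappa>
    proof -
      have "P mu \<kappa> = of_nat (pcoeff mu (\<lambda>k. \<kappa> (k, False)))" if "mu \<in> M" for mu
        unfolding P_def using super_sum_power_sum \<open>\<forall>k. \<kappa> (k, True) = 0\<close> M(2) that by blast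
      then show ?thesis by (simp add: D_def base[OF that])
    qed
    show "D (split_cont k \<kappa>) = D \<kappa>" if "1 \<le> k" for k \<kappa>
      using superization.super_sum_split[OF sup that] superization.super_sum_split[OF psup that]
      by (simp add: D_def P_def)
    show "(\<Sum>i\<le>g. D (\<kappa>((k, False) := i, (k, True) := g - i))) = 0" if "1 \<le> k" "0 < g" for k g \<kappa>
    proof -
      have "(\<Sum>i\<le>g. \<Sum>mu\<in>M. a mu * P mu (\<kappa>((k, False) := i, (k, True) := g - i))) =
        (\<Sum>mu\<in>M. a mu * (\<Sum>i\<le>g. P mu (\<kappa>((k, False) := i, (k, True) := g - i))))"
        by (subst sum.swap) (simp add: sum_distrib_left)
      also have "\<dots> = 0"
        using superization.super_sum_cancel[OF psup that] by (intro sum.neutral) (simp add: P_def)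
      finally show ?thesis
        using superization.super_sum_cancel[OF sup that] by (simp add: D_def sum_subtractf)
    qed
    have "\<kappa> (k, True) \<le> \<alpha> k" for k using \<kappa> by (metis le_add2)
    then have "{k. \<kappa> (k, True) \<noteq> 0} \<subseteq> {k. \<alpha> k \<noteq> 0}" "\<kappa> (0, True) \<le> \<alpha> 0"
      by (auto) (metis less_le_trans)
    then show "finite {k. \<kappa> (k, True) \<noteq> 0}" "\<kappa> (0, True) = 0"
      using \<alpha> by (auto simp: is_exponent_def intro: finite_subset)
  qed
  define T where "T = {\<kappa> :: letter \<Rightarrow> nat. \<forall>k. \<kappa> (k, False) + \<kappa> (k, True) = \<alpha> k}"
  define e where "e = (\<lambda>\<kappa> :: letter \<Rightarrow> nat. t ^ (\<Sum>k | \<alpha> k \<noteq> 0. \<kappa> (k, False)))"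
  have fin: "finite {k. \<alpha> k \<noteq> 0}" using \<alpha> by (simp add: is_exponent_def)
  have "full_sum J m W t \<alpha> = (\<Sum>\<kappa>\<in>T. e \<kappa> * super_sum J m W \<kappa>)"
    unfolding T_def e_def by (rule superization.full_sum_eq_super_sum[OF sup fin])
  also have "\<dots> = (\<Sum>\<kappa>\<in>T. \<Sum>mu\<in>M. a mu * (e \<kappa> * P mu \<kappa>))"
  proof (rule sum.cong[OF refl])
    fix \<kappa> assume "\<kappa> \<in> T"
    then have "super_sum J m W \<kappa> = (\<Sum>mu\<in>M. a mu * P mu \<kappa>)" using D0 by (simp add: T_def D_def)
    then show "e \<kappa> * super_sum J m W \<kappa> = (\<Sum>mu\<in>M. a mu * (e \<kappa> * P mu \<kappa>))"
      by (simp add: sum_distrib_left mult_ac)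
  qed
  also have "\<dots> = (\<Sum>mu\<in>M. a mu * (\<Sum>\<kappa>\<in>T. e \<kappa> * P mu \<kappa>))"
    by (subst sum.swap) (simp add: sum_distrib_left)
  also have "\<dots> = (\<Sum>mu\<in>M. a mu * full_sum {..<length mu} ((!) mu) (\<lambda>_. 1) t \<alpha>)"
    unfolding T_def e_def P_def
    by (intro sum.cong refl arg_cong2[where f = "(*)"] superization.full_sum_eq_super_sum[OF psup fin, symmetric])
  finally show ?thesis by (simp add: full_sum_power_sum mult.assoc)
qed

section \<open>The quinv statistic in the reading order\<close>

text \<open>At equal absolute values only the sign of the first argument counts; every toggling
  argument uses this form.\<close>

lemma Iv_iff: "Iv a b \<longleftrightarrow> fst b < fst a \<or> fst a = fst b \<and> snd a"
  by (cases a; cases b) (auto simp: Iv_def rank1_def)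

lemma Iv_split_letter: "Iv (split_letter k a) (split_letter k b) = Iv a b"
  by (cases a; cases b) (auto simp: Iv_iff split_letter_def rank1_def)

lemma not_Iv_zero: "1 \<le> fst b \<Longrightarrow> \<not> Iv zero_letter b"
  by (simp add: Iv_iff zero_letter_def)

text \<open>The equation fails only for \<open>Iv a b\<close> with neither \<open>Iv c b\<close> nor
  \<open>Iv a c\<close>, or for \<open>Iv a c\<close> and \<open>Iv c b\<close> without
  \<open>Iv a b\<close>. Transitivity excludes both patterns.\<close>

lemma exactly_one_Iv:
  "of_bool (exactly_one (Iv a b) (\<not> Iv c b) (\<not> Iv a c)) + of_bool (Iv a b) =
   of_bool (Iv c b) + (of_bool (Iv a c) :: nat)"
  by (auto simp: Iv_iff exactly_one_def)

lemma finite_dg: "finite (dg lam)"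
proof (rule finite_subset)
  show "dg lam \<subseteq> {..sum_list lam} \<times> {..length lam}"
  proof
    fix u assume "u \<in> dg lam"
    then obtain r i where u: "u = (r, i)" "1 \<le> i" "i \<le> length lam" "r \<le> lam ! (i - 1)"
      by (auto simp: dg_def col_ht_def)
    have "lam ! (i - 1) \<le> sum_list lam" using u by (intro member_le_sum_list nth_mem) auto
    then show "u \<in> {..sum_list lam} \<times> {..length lam}" using u by auto
  qed
qed simp

lemma dg_below: "(Suc r, i) \<in> dg lam \<Longrightarrow> 1 \<le> r \<Longrightarrow> (r, i) \<in> dg lam"
  by (auto simp: dg_def)

lemma fills_outside: "\<sigma> \<in> fills J \<Longrightarrow> u \<notin> J \<Longrightarrow> \<sigma> u = zero_letter"
  unfolding fills_def by blast

lemma fills_pos: "\<sigma> \<in> fills J \<Longrightarrow> u \<in> J \<Longrightarrow> 1 \<le> fst (\<sigma> u)"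
  unfolding fills_def by blast

lemma superfillings_eq_fills: "superfillings lam = fills (dg lam)"
  by (simp add: superfillings_def fills_def)

lemma content_eq_acont: "content lam \<sigma> = acont (dg lam) (\<lambda>_. 1) \<sigma>"
  by (simp add: content_def acont_def fun_eq_iff)

definition row_triples :: "nat list \<Rightarrow> (nat \<times> nat \<times> nat) set" where
  "row_triples lam = {(r, i, j). (r, i) \<in> dg lam \<and> (r, j) \<in> dg lam \<and> i < j}"

lemma finite_row_triples: "finite (row_triples lam)"
proof (rule finite_subset)
  show "row_triples lam \<subseteq> (\<lambda>(u, v). (fst u, snd u, snd v)) ` (dg lam \<times> dg lam)"
    by (force simp: row_triples_def)
qed (simp add: finite_dg)

text \<open>The default value outside the diagram is the letter 0 of a degenerate triple, so one
  formula covers both kinds of triples.\<close>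

lemma quinv_eq:
  assumes "\<sigma> \<in> fills (dg lam)"
  shows "quinv lam \<sigma> = card {(r, i, j) \<in> row_triples lam.
    exactly_one (Iv (\<sigma> (Suc r, i)) (\<sigma> (r, i))) (\<not> Iv (\<sigma> (r, j)) (\<sigma> (r, i))) (\<not> Iv (\<sigma> (Suc r, i)) (\<sigma> (r, j)))}"
proof -
  have z: "(if u \<in> dg lam then \<sigma> u else zero_letter) = \<sigma> u" for u
    using fills_outside[OF assms] by simp
  have "(r, i) \<in> dg lam \<Longrightarrow> (Suc r, i) \<in> dg lam \<or> col_ht lam i = r" for r i
    by (auto simp: dg_def)
  then have "{x. is_quinv_triple lam \<sigma> x} = {(r, i, j) \<in> row_triples lam.
    exactly_one (Iv (\<sigma> (Suc r, i)) (\<sigma> (r, i))) (\<not> Iv (\<sigma> (r, j)) (\<sigma> (r, i))) (\<not> Iv (\<sigma> (Suc r, i)) (\<sigma> (r, j)))}"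
    unfolding is_quinv_triple_def Let_def Suc_eq_plus1[symmetric] z by (auto simp: row_triples_def)
  then show ?thesis by (simp add: quinv_def)
qed

text \<open>Earlier in the reading order (rows from top to bottom, each row from right to left)
  means lexicographically larger. A cell attacks exactly the cells strictly between itself
  and the cell directly below it.\<close>

definition att :: "nat \<times> nat \<Rightarrow> nat \<times> nat \<Rightarrow> bool" where
  "att u v \<longleftrightarrow> fst u = fst v \<and> snd v < snd u \<or> fst u = Suc (fst v) \<and> snd u < snd v"

definition directly_above :: "nat \<times> nat \<Rightarrow> nat \<times> nat \<Rightarrow> bool" where
  "directly_above u v \<longleftrightarrow> fst u = Suc (fst v) \<and> snd u = snd v"

lemma att_or_above_less: "att u v \<or> directly_above u v \<Longrightarrow> v < u"
  by (cases u; cases v) (auto simp: att_def directly_above_def)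

text \<open>The interval property required by \<open>two_letter_symmetry\<close>: attacking pairs
  and vertical pairs are the only ones with nontrivial weight.\<close>

lemma att_between: "att u v \<or> directly_above u v \<Longrightarrow> v < x \<Longrightarrow> x < u \<Longrightarrow> att u x \<and> att x v"
  by (cases u; cases v; cases x) (auto simp: att_def directly_above_def)

lemma att_above_less: "att u x \<Longrightarrow> directly_above u v \<Longrightarrow> v < x"
  by (cases u; cases v; cases x) (auto simp: att_def directly_above_def)

lemma is_descent_iff:
  "is_descent lam \<sigma> u \<longleftrightarrow> u \<in> dg lam \<and> (\<exists>v\<in>dg lam. directly_above u v \<and> Iv (\<sigma> u) (\<sigma> v))"
proof (cases u)
  case (Pair r i)
  show ?thesis
  proof (cases "1 < r")
    case True
    then obtain s where s: "r = Suc s" "1 \<le> s" by (cases r) auto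
    then show ?thesis using Pair dg_below[of s i lam] by (auto simp: is_descent_def directly_above_def intro!: bexI[of _ "(s, i)"])
  next
    case False
    then show ?thesis using Pair by (auto simp: is_descent_def directly_above_def dg_def)
  qed
qed

definition att_inv :: "nat list \<Rightarrow> (nat \<times> nat \<Rightarrow> letter) \<Rightarrow> ((nat \<times> nat) \<times> (nat \<times> nat)) set" where
  "att_inv lam \<sigma> = {(u, v) \<in> dg lam \<times> dg lam. att u v \<and> Iv (\<sigma> u) (\<sigma> v)}"

text \<open>The number of triples having \<open>u\<close> as upper left cell, that is, how often a
  descent at \<open>u\<close> is subtracted when triples are counted.\<close>

definition des_arm :: "nat list \<Rightarrow> nat \<times> nat \<Rightarrow> nat" where
  "des_arm lam u = card {j. snd u < j \<and> (fst u - 1, j) \<in> dg lam}"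

lemma finite_att_inv: "finite (att_inv lam \<sigma>)"
  by (rule finite_subset[of _ "dg lam \<times> dg lam"]) (auto simp: att_inv_def finite_dg)

lemma finite_descents: "finite {u. is_descent lam \<sigma> u}"
  by (rule finite_subset[OF _ finite_dg[of lam]]) (auto simp: is_descent_def)

text \<open>\<open>exactly_one_Iv\<close> summed over all triples. The terms \<open>Iv c b\<close>
  run over attacking pairs within a row, the terms \<open>Iv a c\<close> over those in adjacent
  rows, and each descent appears as \<open>Iv a b\<close> in \<open>des_arm\<close> many triples.
  The subtracted part stands on the left to stay within natural numbers.\<close>

lemma quinv_add_des_arm:
  assumes s: "\<sigma> \<in> fills (dg lam)"
  shows "quinv lam \<sigma> + (\<Sum>u | is_descent lam \<sigma> u. des_arm lam u) = card (att_inv lam \<sigma>)"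
proof -
  define Q where "Q = row_triples lam"
  have finQ: "finite Q" by (simp add: Q_def finite_row_triples)
  define X where "X = (\<lambda>(r, i, j). exactly_one (Iv (\<sigma> (Suc r, i)) (\<sigma> (r, i))) (\<not> Iv (\<sigma> (r, j)) (\<sigma> (r, i))) (\<not> Iv (\<sigma> (Suc r, i)) (\<sigma> (r, j))))"
  define A where "A = (\<lambda>(r, i, j::nat). Iv (\<sigma> (Suc r, i)) (\<sigma> (r, i)))"
  define B where "B = (\<lambda>(r, i, j). Iv (\<sigma> (r, j)) (\<sigma> (r, i)))"
  define C where "C = (\<lambda>(r, i, j). Iv (\<sigma> (Suc r, i)) (\<sigma> (r, j)))"
  have card_eq: "card {x\<in>Q. P x} = (\<Sum>x\<in>Q. of_bool (P x))" for P
    using finQ by (simp add: sum.If_cases of_bool_def Int_def)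
  have "quinv lam \<sigma> = card {x\<in>Q. X x}"
    unfolding quinv_eq[OF s] Q_def X_def by (rule arg_cong[of _ _ card]) auto
  then have sum: "quinv lam \<sigma> + card {x\<in>Q. A x} = card {x\<in>Q. B x} + card {x\<in>Q. C x}"
    unfolding card_eq by (simp add: sum.distrib[symmetric] X_def A_def B_def C_def split_def exactly_one_Iv)
  \<comment> \<open>The letter 0 is never above a letter, so a triple with \<open>Iv\<close> true on
    its upper left cell is not degenerate.\<close>
  have top: "(Suc r, i) \<in> dg lam" if "(r, j) \<in> dg lam" "Iv (\<sigma> (Suc r, i)) (\<sigma> (r, j))" for r i j
  proof (rule ccontr)
    assume "(Suc r, i) \<notin> dg lam"
    then show False using that not_Iv_zero fills_outside[OF s] fills_pos[OF s] by metis
  qed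
  have "card {x\<in>Q. B x} = card {(u, v) \<in> att_inv lam \<sigma>. fst u = fst v}"
    by (rule bij_betw_same_card[of "\<lambda>(r, i, j). ((r, j), (r, i))"], rule bij_betwI[where g = "\<lambda>(u, v). (fst u, snd v, snd u)"])
      (auto simp: Q_def row_triples_def B_def att_inv_def att_def)
  moreover have "card {x\<in>Q. C x} = card {(u, v) \<in> att_inv lam \<sigma>. fst u \<noteq> fst v}"
  proof (rule bij_betw_same_card, rule bij_betwI[where g = "\<lambda>(u, v). (fst v, snd u, snd v)"])
    show "(\<lambda>(r, i, j). ((Suc r, i), (r, j))) \<in> {x\<in>Q. C x} \<rightarrow> {(u, v) \<in> att_inv lam \<sigma>. fst u \<noteq> fst v}"
    proof
      fix x assume "x \<in> {x\<in>Q. C x}"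
      then obtain r i j where x: "x = (r, i, j)" "(r, j) \<in> dg lam" "i < j" "Iv (\<sigma> (Suc r, i)) (\<sigma> (r, j))"
        by (auto simp: Q_def row_triples_def C_def)
      then show "(case x of (r, i, j) \<Rightarrow> ((Suc r, i), (r, j))) \<in> {(u, v) \<in> att_inv lam \<sigma>. fst u \<noteq> fst v}"
        using top[OF x(2,4)] by (simp add: att_inv_def att_def)
    qed
    show "(\<lambda>(u, v). (fst v, snd u, snd v)) \<in> {(u, v) \<in> att_inv lam \<sigma>. fst u \<noteq> fst v} \<rightarrow> {x\<in>Q. C x}"
    proof
      fix y assume "y \<in> {(u, v) \<in> att_inv lam \<sigma>. fst u \<noteq> fst v}"
      then obtain r i j where y: "y = ((Suc r, i), (r, j))" "(Suc r, i) \<in> dg lam" "(r, j) \<in> dg lam" "i < j" "Iv (\<sigma> (Suc r, i)) (\<sigma> (r, j))"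
        by (auto simp: att_inv_def att_def)
      have "1 \<le> r" using y(3) by (simp add: dg_def)
      then show "(case y of (u, v) \<Rightarrow> (fst v, snd u, snd v)) \<in> {x\<in>Q. C x}"
        using y dg_below[OF y(2)] by (simp add: Q_def row_triples_def C_def)
    qed
  qed (auto simp: att_inv_def att_def)
  moreover have "card (att_inv lam \<sigma>) = card {(u, v) \<in> att_inv lam \<sigma>. fst u = fst v} + card {(u, v) \<in> att_inv lam \<sigma>. fst u \<noteq> fst v}"
    by (subst card_Un_disjoint[symmetric]) (auto intro!: arg_cong[of _ _ card] finite_subset[OF _ finite_att_inv[of lam \<sigma>]])
  moreover have "card {x\<in>Q. A x} = (\<Sum>u | is_descent lam \<sigma> u. des_arm lam u)"
  proof -
    have fin: "finite {j. snd u < j \<and> (fst u - 1, j) \<in> dg lam}" for u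
      by (rule finite_subset[of _ "snd ` dg lam"]) (auto simp: finite_dg image_iff, force)
    have "card {x\<in>Q. A x} = card (SIGMA u:{u. is_descent lam \<sigma> u}. {j. snd u < j \<and> (fst u - 1, j) \<in> dg lam})"
    proof (rule bij_betw_same_card, rule bij_betwI[where g = "\<lambda>(u, j). (fst u - 1, snd u, j)"])
      show "(\<lambda>(r, i, j). ((Suc r, i), j)) \<in> {x\<in>Q. A x} \<rightarrow> (SIGMA u:{u. is_descent lam \<sigma> u}. {j. snd u < j \<and> (fst u - 1, j) \<in> dg lam})"
      proof
        fix x assume "x \<in> {x\<in>Q. A x}"
        then obtain r i j where x: "x = (r, i, j)" "(r, i) \<in> dg lam" "(r, j) \<in> dg lam" "i < j" "Iv (\<sigma> (Suc r, i)) (\<sigma> (r, i))"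
          by (auto simp: Q_def row_triples_def A_def)
        moreover have "1 \<le> r" using x(2) by (simp add: dg_def)
        ultimately show "(case x of (r, i, j) \<Rightarrow> ((Suc r, i), j)) \<in> (SIGMA u:{u. is_descent lam \<sigma> u}. {j. snd u < j \<and> (fst u - 1, j) \<in> dg lam})"
          using top[OF x(2,5)] by (simp add: is_descent_def)
      qed
      show "(\<lambda>(u, j). (fst u - 1, snd u, j)) \<in> (SIGMA u:{u. is_descent lam \<sigma> u}. {j. snd u < j \<and> (fst u - 1, j) \<in> dg lam}) \<rightarrow> {x\<in>Q. A x}"
      proof
        fix y assume "y \<in> (SIGMA u:{u. is_descent lam \<sigma> u}. {j. snd u < j \<and> (fst u - 1, j) \<in> dg lam})"
        then obtain r i j where y: "y = ((r, i), j)" "is_descent lam \<sigma> (r, i)" "i < j" "(r - 1, j) \<in> dg lam"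
          by auto
        then obtain s where s: "r = Suc s" "1 \<le> s" by (cases r) (auto simp: is_descent_def)
        then show "(case y of (u, j) \<Rightarrow> (fst u - 1, snd u, j)) \<in> {x\<in>Q. A x}"
          using y dg_below[of s i lam] by (simp add: is_descent_def Q_def row_triples_def A_def)
      qed
    qed (auto simp: is_descent_def)
    also have "\<dots> = (\<Sum>u | is_descent lam \<sigma> u. des_arm lam u)"
      unfolding des_arm_def by (intro card_SigmaI finite_descents ballI fin)
    finally show ?thesis .
  qed
  ultimately show ?thesis using sum by simp
qed

text \<open>Descents and attacking pairs only compare a cell with a later one in the reading
  order.\<close>

lemma maj_quinv_cong:
  assumes "\<sigma> \<in> fills (dg lam)" "\<tau> \<in> fills (dg lam)"
    and I: "\<And>u v. u \<in> dg lam \<Longrightarrow> v \<in> dg lam \<Longrightarrow> v < u \<Longrightarrow> Iv (\<sigma> u) (\<sigma> v) = Iv (\<tau> u) (\<tau> v)"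
  shows "maj lam \<sigma> = maj lam \<tau>" "quinv lam \<sigma> = quinv lam \<tau>"
proof -
  have des: "is_descent lam \<sigma> u = is_descent lam \<tau> u" for u
    unfolding is_descent_iff using I att_or_above_less by blast
  then show "maj lam \<sigma> = maj lam \<tau>" by (simp add: maj_def)
  have "att_inv lam \<sigma> = att_inv lam \<tau>"
    unfolding att_inv_def using I att_or_above_less by blast
  then show "quinv lam \<sigma> = quinv lam \<tau>"
    using quinv_add_des_arm[OF assms(1)] quinv_add_des_arm[OF assms(2)] des by simp
qed

lemma superization_quinv:
  "superization (dg lam) (\<lambda>_. 1) (\<lambda>\<sigma>. q ^ maj lam \<sigma> * t ^ quinv lam \<sigma> :: 'a::field_char_0) Min"
proof
  show "finite (dg lam)" by (rule finite_dg)
  show "Min A \<in> A" if "A \<subseteq> dg lam" "A \<noteq> {}" for A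
    using that finite_dg by (meson Min_in finite_subset)
next
  fix \<sigma> k assume s: "\<sigma> \<in> fills (dg lam)" "(1::nat) \<le> k"
  have "split_letter k zero_letter = zero_letter"
    by (simp add: split_letter_def zero_letter_def rank1_def)
  moreover have "1 \<le> fst (split_letter k l)" if "1 \<le> fst l" for l
    using that by (auto simp: split_letter_def)
  ultimately have "split_letter k \<circ> \<sigma> \<in> fills (dg lam)" using s by (auto simp: fills_def)
  then show "q ^ maj lam (split_letter k \<circ> \<sigma>) * t ^ quinv lam (split_letter k \<circ> \<sigma>) = q ^ maj lam \<sigma> * t ^ quinv lam \<sigma>"
    using maj_quinv_cong[OF _ s(1), of "split_letter k \<circ> \<sigma>"] by (simp add: Iv_split_letter)
next
  fix \<sigma> k assume s: "\<sigma> \<in> fills (dg lam)" "(1::nat) \<le> k" and ne: "{u \<in> dg lam. fst (\<sigma> u) = k} \<noteq> {}"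
  define p where "p = Min {u \<in> dg lam. fst (\<sigma> u) = k}"
  have fin: "finite {u \<in> dg lam. fst (\<sigma> u) = k}" by (simp add: finite_dg)
  have p: "p \<in> dg lam" "fst (\<sigma> p) = k" using Min_in[OF fin ne] by (auto simp: p_def)
  have later: "fst (\<sigma> v) \<noteq> k" if "v \<in> dg lam" "v < p" for v
    using Min_le[OF fin, of v] that by (auto simp: p_def)
  \<comment> \<open>The sign of \<open>p\<close> matters only in a tie with a later cell, and
    \<open>p\<close> is the last cell of absolute value \<open>k\<close>.\<close>
  have "Iv (toggle p \<sigma> u) (toggle p \<sigma> v) = Iv (\<sigma> u) (\<sigma> v)" if "u \<in> dg lam" "v \<in> dg lam" "v < u" for u v
    using later[of v] that p by (cases "u = p") (auto simp: Iv_iff toggle_def)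
  then show "q ^ maj lam (toggle (Min {u \<in> dg lam. fst (\<sigma> u) = k}) \<sigma>) * t ^ quinv lam (toggle (Min {u \<in> dg lam. fst (\<sigma> u) = k}) \<sigma>) = q ^ maj lam \<sigma> * t ^ quinv lam \<sigma>"
    using maj_quinv_cong[OF toggle_in_fills[OF s(1) p(1)] s(1)] unfolding p_def by simp
qed simp

lemma super_sum_eq_C_ser:
  assumes "\<forall>k. \<kappa> (k, True) = 0"
  shows "super_sum (dg lam) (\<lambda>_. 1) (\<lambda>\<sigma>. q ^ maj lam \<sigma> * t ^ quinv lam \<sigma>) \<kappa> = C_ser lam q t (\<lambda>k. \<kappa> (k, False))"
proof -
  have eq: "\<sigma> \<in> fills (dg lam) \<and> lcont (dg lam) (\<lambda>_. 1) \<sigma> = \<kappa> \<longleftrightarrow>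
     \<sigma> \<in> posfillings lam \<and> content lam \<sigma> = (\<lambda>k. \<kappa> (k, False))" for \<sigma>
  proof
    assume a: "\<sigma> \<in> fills (dg lam) \<and> lcont (dg lam) (\<lambda>_. 1) \<sigma> = \<kappa>"
    have "\<not> snd (\<sigma> u)" if "u \<in> dg lam" for u
    proof
      assume "snd (\<sigma> u)"
      then obtain k where "\<sigma> u = (k, True)" by (cases "\<sigma> u") auto
      moreover have "0 < lcont (dg lam) (\<lambda>_. 1) \<sigma> (\<sigma> u)"
        unfolding lcont_def
      proof (rule sum_pos)
        show "{v \<in> dg lam. \<sigma> v = \<sigma> u} \<noteq> {}" using that by blast
      qed (simp_all add: finite_dg)
      ultimately show False using a assms by simp
    qed
    moreover have "content lam \<sigma> k = \<kappa> (k, False)" for k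
      unfolding content_eq_acont acont_eq_lcont[OF finite_dg] using a assms by simp
    ultimately show "\<sigma> \<in> posfillings lam \<and> content lam \<sigma> = (\<lambda>k. \<kappa> (k, False))"
      using a by (auto simp: posfillings_def superfillings_eq_fills)
  next
    assume a: "\<sigma> \<in> posfillings lam \<and> content lam \<sigma> = (\<lambda>k. \<kappa> (k, False))"
    have e: "{u \<in> dg lam. \<sigma> u = (k, True)} = {}" for k using a by (auto simp: posfillings_def)
    have l: "lcont (dg lam) (\<lambda>_. 1) \<sigma> (k, True) = 0" for k unfolding lcont_def e by simp
    have "lcont (dg lam) (\<lambda>_. 1) \<sigma> (k, s) = \<kappa> (k, s)" for k s
    proof (cases s)
      case False
      have "\<kappa> (k, False) = acont (dg lam) (\<lambda>_. 1) \<sigma> k" using a content_eq_acont[of lam \<sigma>] by metis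
      then show ?thesis using False l by (simp add: acont_eq_lcont[OF finite_dg])
    qed (use l assms in simp)
    then show "\<sigma> \<in> fills (dg lam) \<and> lcont (dg lam) (\<lambda>_. 1) \<sigma> = \<kappa>"
      using a by (auto simp: posfillings_def superfillings_eq_fills)
  qed
  have "{u \<in> dg lam. snd (\<sigma> u)} = {}" if "\<sigma> \<in> posfillings lam" for \<sigma>
    using that by (auto simp: posfillings_def)
  then show ?thesis unfolding super_sum_def C_ser_def eq
    by (intro sum.cong) (auto simp del: Collect_empty_eq)
qed

section \<open>Symmetry of the positive generating function\<close>

declare split_paired_All [simp del] split_paired_Ex [simp del]

text \<open>A descent at \<open>u\<close> adds \<open>leg lam u + 1\<close> to \<open>maj\<close>
  and takes \<open>des_arm lam u\<close> off the count of attacking inversions, hence the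
  quotient.\<close>

definition cell_weight :: "nat list \<Rightarrow> 'a::field \<Rightarrow> 'a \<Rightarrow> nat \<times> nat \<Rightarrow> nat \<times> nat \<Rightarrow> 'a" where
  "cell_weight lam q t u v =
     (if att u v then t else if directly_above u v then q ^ (leg lam u + 1) / t ^ des_arm lam u else 1)"

lemma cell_weight_neq_1: "cell_weight lam q t u v \<noteq> 1 \<Longrightarrow>
    v < u \<and> (\<forall>x. v < x \<and> x < u \<longrightarrow> cell_weight lam q t u x = t \<and> cell_weight lam q t x v = t)"
proof -
  assume "cell_weight lam q t u v \<noteq> 1"
  then have a: "att u v \<or> directly_above u v" by (auto simp: cell_weight_def split: if_splits)
  have "cell_weight lam q t u x = t \<and> cell_weight lam q t x v = t" if "v < x \<and> x < u" for x
    using att_between[OF a] that by (simp add: cell_weight_def)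
  with att_or_above_less[OF a] show ?thesis by blast
qed

lemma maj_quinv_eq_prod:
  fixes q t :: "'a::field"
  assumes t: "t \<noteq> 0" and s: "\<sigma> \<in> fills (dg lam)"
  shows "q ^ maj lam \<sigma> * t ^ quinv lam \<sigma> =
    (\<Prod>u\<in>dg lam. \<Prod>v\<in>dg lam. if Iv (\<sigma> u) (\<sigma> v) then cell_weight lam q t u v else 1)"
proof -
  define D where "D = dg lam"
  have finD: "finite D" by (simp add: D_def finite_dg)
  define d where "d = (\<lambda>u. q ^ (leg lam u + 1) / t ^ des_arm lam u)"
  have ex: "\<not> (att u v \<and> directly_above u v)" for u v by (auto simp: att_def directly_above_def)
  have "(\<Prod>u\<in>D. \<Prod>v\<in>D. if Iv (\<sigma> u) (\<sigma> v) then cell_weight lam q t u v else 1) =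
     (\<Prod>u\<in>D. \<Prod>v\<in>D. if att u v \<and> Iv (\<sigma> u) (\<sigma> v) then t else 1) *
     (\<Prod>u\<in>D. \<Prod>v\<in>D. if directly_above u v \<and> Iv (\<sigma> u) (\<sigma> v) then d u else 1)"
    unfolding prod.distrib[symmetric] using ex
    by (intro prod.cong refl) (auto simp: cell_weight_def d_def)
  also have "(\<Prod>u\<in>D. \<Prod>v\<in>D. if att u v \<and> Iv (\<sigma> u) (\<sigma> v) then t else 1) = t ^ card (att_inv lam \<sigma>)"
  proof -
    have "(\<Prod>u\<in>D. \<Prod>v\<in>D. if att u v \<and> Iv (\<sigma> u) (\<sigma> v) then t else 1) =
       (\<Prod>x\<in>D\<times>D. if att (fst x) (snd x) \<and> Iv (\<sigma> (fst x)) (\<sigma> (snd x)) then t else 1)"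
      by (simp add: prod.cartesian_product split_def)
    also have "\<dots> = (\<Prod>x\<in>{x\<in>D\<times>D. att (fst x) (snd x) \<and> Iv (\<sigma> (fst x)) (\<sigma> (snd x))}. t)"
      by (rule prod.inter_filter[symmetric]) (simp add: finD)
    also have "{x\<in>D\<times>D. att (fst x) (snd x) \<and> Iv (\<sigma> (fst x)) (\<sigma> (snd x))} = att_inv lam \<sigma>"
      by (auto simp: att_inv_def D_def)
    finally show ?thesis by simp
  qed
  also have "(\<Prod>u\<in>D. \<Prod>v\<in>D. if directly_above u v \<and> Iv (\<sigma> u) (\<sigma> v) then d u else 1) = (\<Prod>u | is_descent lam \<sigma> u. d u)"
  proof -
    have "(\<Prod>v\<in>D. if directly_above u v \<and> Iv (\<sigma> u) (\<sigma> v) then d u else 1) = (if is_descent lam \<sigma> u then d u else 1)"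
      if "u \<in> D" for u
    proof (cases "is_descent lam \<sigma> u")
      case True
      then obtain v where v: "v \<in> D" "directly_above u v" "Iv (\<sigma> u) (\<sigma> v)" by (auto simp: is_descent_iff D_def)
      have "{x\<in>D. directly_above u x \<and> Iv (\<sigma> u) (\<sigma> x)} = {v}" using v by (auto simp: directly_above_def prod_eq_iff)
      moreover have "(\<Prod>v\<in>D. if directly_above u v \<and> Iv (\<sigma> u) (\<sigma> v) then d u else 1) =
          (\<Prod>v\<in>{x\<in>D. directly_above u x \<and> Iv (\<sigma> u) (\<sigma> x)}. d u)"
        by (rule prod.inter_filter[symmetric]) (rule finD)
      ultimately show ?thesis using True by simp
    next
      case False
      then have "\<not> (directly_above u v \<and> Iv (\<sigma> u) (\<sigma> v))" if "v \<in> D" for v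
        using \<open>u \<in> D\<close> that by (auto simp: is_descent_iff D_def)
      then show ?thesis using False by (auto intro!: prod.neutral)
    qed
    then have "(\<Prod>u\<in>D. \<Prod>v\<in>D. if directly_above u v \<and> Iv (\<sigma> u) (\<sigma> v) then d u else 1) =
        (\<Prod>u\<in>D. if is_descent lam \<sigma> u then d u else 1)" by simp
    also have "\<dots> = (\<Prod>u\<in>{u\<in>D. is_descent lam \<sigma> u}. d u)"
      by (rule prod.inter_filter[symmetric]) (rule finD)
    also have "{u\<in>D. is_descent lam \<sigma> u} = {u. is_descent lam \<sigma> u}" by (auto simp: is_descent_def D_def)
    finally show ?thesis .
  qed
  also have "(\<Prod>u | is_descent lam \<sigma> u. d u) =
      q ^ maj lam \<sigma> / t ^ (\<Sum>u | is_descent lam \<sigma> u. des_arm lam u)"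
    unfolding d_def prod_dividef maj_def by (simp only: power_sum)
  \<comment> \<open>The denominators from descents cancel precisely the excess of the attacking
    inversions over \<open>quinv\<close>.\<close>
  also have "t ^ card (att_inv lam \<sigma>) = t ^ quinv lam \<sigma> * t ^ (\<Sum>u | is_descent lam \<sigma> u. des_arm lam u)"
    unfolding quinv_add_des_arm[OF s, symmetric] by (rule power_add)
  finally show ?thesis using t by (simp add: D_def)
qed

section \<open>Fillings that differ only in two adjacent letters\<close>

definition raise :: "nat \<Rightarrow> (nat \<times> nat \<Rightarrow> letter) \<Rightarrow> (nat \<times> nat) set \<Rightarrow> nat \<times> nat \<Rightarrow> letter" where
  "raise k \<tau> S u = (if u \<in> S then (Suc k, False) else \<tau> u)"

text \<open>The content after every \<open>Suc k\<close> is lowered to \<open>k\<close>. Exchanging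
  the exponents of \<open>k\<close> and \<open>Suc k\<close> leaves it unchanged.\<close>

definition merge_cont :: "nat \<Rightarrow> (nat \<Rightarrow> nat) \<Rightarrow> nat \<Rightarrow> nat" where
  "merge_cont k \<alpha> = \<alpha>(k := \<alpha> k + \<alpha> (Suc k), Suc k := 0)"

definition kcells :: "nat list \<Rightarrow> nat \<Rightarrow> (nat \<times> nat \<Rightarrow> letter) \<Rightarrow> (nat \<times> nat) set" where
  "kcells lam k \<sigma> = {u \<in> dg lam. fst (\<sigma> u) = k}"

lemma finite_kcells: "finite (kcells lam k \<sigma>)"
  by (simp add: kcells_def finite_dg)

lemma content_eq_card_kcells: "content lam \<sigma> k = card (kcells lam k \<sigma>)"
  by (simp add: content_def kcells_def)

lemma posfillings_iff: "\<sigma> \<in> posfillings lam \<longleftrightarrow> \<sigma> \<in> fills (dg lam) \<and> (\<forall>u. \<not> snd (\<sigma> u))"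
proof -
  have "\<not> snd (\<sigma> u)" if "\<sigma> \<in> fills (dg lam)" "\<forall>u\<in>dg lam. \<not> snd (\<sigma> u)" for u
    using fills_outside[OF that(1), of u] that(2) by (cases "u \<in> dg lam") (auto simp: zero_letter_def)
  then show ?thesis by (auto simp: posfillings_def superfillings_eq_fills)
qed

lemma finite_posfillings_content: "finite {\<sigma> \<in> posfillings lam. content lam \<sigma> = \<alpha>}"
proof (rule finite_subset)
  show "{\<sigma> \<in> posfillings lam. content lam \<sigma> = \<alpha>} \<subseteq> {\<sigma> \<in> fills (dg lam). acont (dg lam) (\<lambda>_. 1) \<sigma> = \<alpha>}"
    by (auto simp: posfillings_def superfillings_eq_fills content_eq_acont)
  show "finite {\<sigma> \<in> fills (dg lam). acont (dg lam) (\<lambda>_. 1) \<sigma> = \<alpha>}"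
    by (rule finite_fills_acont[OF finite_dg]) simp
qed

lemma kcells_Suc_empty:
  assumes "content lam \<tau> = merge_cont k \<alpha>"
  shows "kcells lam (Suc k) \<tau> = {}"
proof -
  have "card (kcells lam (Suc k) \<tau>) = 0"
    using assms content_eq_card_kcells[of lam \<tau> "Suc k"] by (simp add: merge_cont_def)
  then show ?thesis using finite_kcells by simp
qed

text \<open>A filling is its lowered version \<open>\<tau>\<close> together with the set
  \<open>S\<close> of cells that held \<open>Suc k\<close>. Only the size of \<open>S\<close>
  distinguishes \<open>\<alpha>\<close> from its exchange.\<close>

lemma C_ser_eq_merged:
  assumes k: "1 \<le> k"
  shows "C_ser lam q t \<alpha> = (\<Sum>\<tau>\<in>{\<tau> \<in> posfillings lam. content lam \<tau> = merge_cont k \<alpha>}.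
     \<Sum>S\<in>{S \<in> Pow (kcells lam k \<tau>). card S = \<alpha> (Suc k)}.
       q ^ maj lam (raise k \<tau> S) * t ^ quinv lam (raise k \<tau> S))"
proof -
  define T where "T = {\<tau> \<in> posfillings lam. content lam \<tau> = merge_cont k \<alpha>}"
  define P where "P = (\<lambda>\<tau>. {S \<in> Pow (kcells lam k \<tau>). card S = \<alpha> (Suc k)})"
  define W where "W = (\<lambda>\<sigma>. q ^ maj lam \<sigma> * t ^ quinv lam \<sigma>)"
  define lower where "lower = (\<lambda>(\<sigma> :: nat \<times> nat \<Rightarrow> letter) u. if \<sigma> u = (Suc k, False) then (k, False) else \<sigma> u)"
  have "C_ser lam q t \<alpha> = (\<Sum>(\<tau>, S)\<in>(SIGMA \<tau>:T. P \<tau>). W (raise k \<tau> S))"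
    unfolding C_ser_def W_def[symmetric]
  proof (rule sum.reindex_bij_witness[of _ "\<lambda>(\<tau>, S). raise k \<tau> S" "\<lambda>\<sigma>. (lower \<sigma>, kcells lam (Suc k) \<sigma>)"])
    fix \<sigma> assume "\<sigma> \<in> {\<sigma> \<in> posfillings lam. content lam \<sigma> = \<alpha>}"
    then have s: "\<sigma> \<in> posfillings lam" "content lam \<sigma> = \<alpha>" by auto
    have sf: "\<sigma> \<in> fills (dg lam)" and neg: "\<not> snd (\<sigma> u)" for u using s(1) by (auto simp: posfillings_iff)
    have iff: "u \<in> kcells lam (Suc k) \<sigma> \<longleftrightarrow> \<sigma> u = (Suc k, False)" for u
      using neg[of u] fills_outside[OF sf, of u]
      by (cases "u \<in> dg lam") (auto simp: kcells_def zero_letter_def prod_eq_iff)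
    show r: "(case (lower \<sigma>, kcells lam (Suc k) \<sigma>) of (\<tau>, S) \<Rightarrow> raise k \<tau> S) = \<sigma>"
      by (auto simp: raise_def lower_def iff)
    have low: "lower \<sigma> \<in> posfillings lam"
      using sf k neg by (auto simp: posfillings_iff fills_def lower_def zero_letter_def)
    have fl: "fst (lower \<sigma> u) = (if fst (\<sigma> u) = Suc k then k else fst (\<sigma> u))" for u
      using neg[of u] by (auto simp: lower_def prod_eq_iff)
    have card: "card (kcells lam i \<sigma>) = \<alpha> i" for i
      using s(2) content_eq_card_kcells by metis
    have kk: "kcells lam k (lower \<sigma>) = kcells lam k \<sigma> \<union> kcells lam (Suc k) \<sigma>"
      by (auto simp: kcells_def fl split: if_splits)
    have "content lam (lower \<sigma>) i = merge_cont k \<alpha> i" for i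
    proof -
      consider "i = k" | "i = Suc k" | "i \<noteq> k" "i \<noteq> Suc k" by blast
      then show ?thesis
      proof cases
        case 1
        have "kcells lam k \<sigma> \<inter> kcells lam (Suc k) \<sigma> = {}" by (auto simp: kcells_def)
        then show ?thesis using 1
          by (simp add: content_eq_card_kcells kk merge_cont_def card_Un_disjoint finite_kcells card)
      next
        case 2
        then have "kcells lam i (lower \<sigma>) = {}" by (auto simp: kcells_def fl split: if_splits)
        then show ?thesis using 2 by (simp add: content_eq_card_kcells merge_cont_def)
      next
        case 3
        then have "kcells lam i (lower \<sigma>) = kcells lam i \<sigma>" by (auto simp: kcells_def fl split: if_splits)
        then show ?thesis using 3 by (simp add: content_eq_card_kcells merge_cont_def card)
      qed
    qed
    then have "lower \<sigma> \<in> T" using low by (auto simp: T_def)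
    moreover have "kcells lam (Suc k) \<sigma> \<in> P (lower \<sigma>)" by (auto simp: P_def kk card)
    ultimately show "(lower \<sigma>, kcells lam (Suc k) \<sigma>) \<in> (SIGMA \<tau>:T. P \<tau>)" by simp
    show "(case (lower \<sigma>, kcells lam (Suc k) \<sigma>) of (\<tau>, S) \<Rightarrow> W (raise k \<tau> S)) = W \<sigma>"
      using r by simp
  next
    fix x assume "x \<in> (SIGMA \<tau>:T. P \<tau>)"
    then obtain \<tau> S where x: "x = (\<tau>, S)" "\<tau> \<in> posfillings lam" "content lam \<tau> = merge_cont k \<alpha>"
        "S \<subseteq> kcells lam k \<tau>" "card S = \<alpha> (Suc k)"
      by (auto simp: T_def P_def)
    have Sd: "S \<subseteq> dg lam" using x(4) by (auto simp: kcells_def)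
    have Sk: "\<tau> u = (k, False)" if "u \<in> S" for u
    proof -
      have "fst (\<tau> u) = k" using x(4) that by (auto simp: kcells_def)
      then show ?thesis using x(2) by (simp add: posfillings_iff prod_eq_iff)
    qed
    note e = kcells_Suc_empty[OF x(3)]
    have nk: "\<tau> u \<noteq> (Suc k, False)" for u
    proof
      assume a: "\<tau> u = (Suc k, False)"
      then have "u \<in> dg lam" using x(2) by (auto simp: posfillings_iff fills_def zero_letter_def)
      then show False using e a by (auto simp: kcells_def)
    qed
    have pos: "raise k \<tau> S \<in> posfillings lam"
      using x(2) Sd by (auto simp: posfillings_iff fills_def raise_def)
    have ks: "kcells lam (Suc k) (raise k \<tau> S) = S" using e Sd by (auto simp: kcells_def raise_def)
    have "lower (raise k \<tau> S) = \<tau>" using nk Sk by (auto simp: lower_def raise_def fun_eq_iff)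
    then show "(lower (case x of (\<tau>, S) \<Rightarrow> raise k \<tau> S), kcells lam (Suc k) (case x of (\<tau>, S) \<Rightarrow> raise k \<tau> S)) = x"
      using x(1) ks by simp
    have "content lam (raise k \<tau> S) i = \<alpha> i" for i
    proof -
      consider "i = k" | "i = Suc k" | "i \<noteq> k" "i \<noteq> Suc k" by blast
      then show ?thesis
      proof cases
        case 1
        have "kcells lam k (raise k \<tau> S) = kcells lam k \<tau> - S" by (auto simp: kcells_def raise_def)
        moreover have "card (kcells lam k \<tau>) = \<alpha> k + \<alpha> (Suc k)"
          using fun_cong[OF x(3), of k] by (simp add: content_eq_card_kcells merge_cont_def)
        moreover have "finite S" using x(4) finite_kcells finite_subset by blast
        ultimately show ?thesis using 1 x(4,5) by (simp add: content_eq_card_kcells card_Diff_subset)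
      next
        case 2
        then show ?thesis using ks x(5) by (simp add: content_eq_card_kcells)
      next
        case 3
        then have "kcells lam i (raise k \<tau> S) = kcells lam i \<tau>" using Sk by (auto simp: kcells_def raise_def)
        then show ?thesis using 3 fun_cong[OF x(3), of i] by (simp add: content_eq_card_kcells merge_cont_def)
      qed
    qed
    then show "(case x of (\<tau>, S) \<Rightarrow> raise k \<tau> S) \<in> {\<sigma> \<in> posfillings lam. content lam \<sigma> = \<alpha>}"
      using x(1) pos by auto
  qed
  also have "\<dots> = (\<Sum>\<tau>\<in>T. \<Sum>S\<in>P \<tau>. W (raise k \<tau> S))"
  proof (rule sum.Sigma[symmetric])
    show "finite T" unfolding T_def by (rule finite_posfillings_content)
    show "\<forall>\<tau>\<in>T. finite (P \<tau>)" using finite_kcells by (auto simp: P_def)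
  qed
  finally show ?thesis by (simp add: T_def P_def W_def)
qed

text \<open>Since \<open>\<tau>\<close> does not use \<open>Suc k\<close>, raising \<open>S\<close>
  changes \<open>Iv\<close> only on pairs from \<open>S\<close> to the rest of the
  \<open>k\<close>-cells, where a tie of positive letters becomes strict.\<close>

lemma weight_raise:
  fixes q t :: "'a::field"
  assumes t: "t \<noteq> 0" and tau: "\<tau> \<in> posfillings lam" and e: "kcells lam (Suc k) \<tau> = {}"
    and S: "S \<subseteq> kcells lam k \<tau>"
  shows "q ^ maj lam (raise k \<tau> S) * t ^ quinv lam (raise k \<tau> S) =
    q ^ maj lam \<tau> * t ^ quinv lam \<tau> * (\<Prod>u\<in>S. \<Prod>v\<in>kcells lam k \<tau> - S. cell_weight lam q t u v)"
proof -
  define D where "D = dg lam"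
  define V where "V = kcells lam k \<tau>"
  define w where "w = cell_weight lam q t"
  have finD: "finite D" by (simp add: D_def finite_dg)
  have tf: "\<tau> \<in> fills (dg lam)" using tau by (simp add: posfillings_iff)
  have sub: "S \<subseteq> V" "V \<subseteq> D" using S by (auto simp: V_def D_def kcells_def)
  have rf: "raise k \<tau> S \<in> fills (dg lam)"
    using tf sub by (auto simp: fills_def raise_def D_def)
  have neg: "\<not> snd (\<tau> u)" for u using tau by (simp add: posfillings_iff)
  have Vk: "fst (\<tau> u) = k \<longleftrightarrow> u \<in> V" if "u \<in> D" for u using that by (auto simp: V_def kcells_def D_def)
  have nSk: "fst (\<tau> u) \<noteq> Suc k" if "u \<in> D" for u using that e by (auto simp: kcells_def D_def)
  have Iv: "Iv (raise k \<tau> S u) (raise k \<tau> S v) \<longleftrightarrow> Iv (\<tau> u) (\<tau> v) \<or> (u \<in> S \<and> v \<in> V - S)"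
    and ex: "\<not> (Iv (\<tau> u) (\<tau> v) \<and> u \<in> S \<and> v \<in> V - S)" if "u \<in> D" "v \<in> D" for u v
    using that Vk[of u] Vk[of v] nSk[of u] nSk[of v] neg[of u] sub
    by (auto simp: Iv_iff raise_def)
  have "(\<Prod>u\<in>D. \<Prod>v\<in>D. if Iv (raise k \<tau> S u) (raise k \<tau> S v) then w u v else 1) =
     (\<Prod>u\<in>D. \<Prod>v\<in>D. if Iv (\<tau> u) (\<tau> v) then w u v else 1) *
     (\<Prod>u\<in>D. \<Prod>v\<in>D. if u \<in> S \<and> v \<in> V - S then w u v else 1)"
    unfolding prod.distrib[symmetric] using Iv ex by (intro prod.cong refl) auto
  also have "(\<Prod>u\<in>D. \<Prod>v\<in>D. if u \<in> S \<and> v \<in> V - S then w u v else 1) = (\<Prod>u\<in>S. \<Prod>v\<in>V-S. w u v)"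
  proof -
    have "(\<Prod>v\<in>D. if u \<in> S \<and> v \<in> V - S then w u v else 1) = (if u \<in> S then \<Prod>v\<in>V-S. w u v else 1)" for u
    proof -
      have "(\<Prod>v\<in>D. if v \<in> V - S then w u v else 1) = (\<Prod>v\<in>{v\<in>D. v \<in> V - S}. w u v)"
        by (rule prod.inter_filter[symmetric]) (rule finD)
      moreover have "{v\<in>D. v \<in> V - S} = V - S" using sub by auto
      ultimately show ?thesis by (cases "u \<in> S") simp_all
    qed
    then have "(\<Prod>u\<in>D. \<Prod>v\<in>D. if u \<in> S \<and> v \<in> V - S then w u v else 1) =
       (\<Prod>u\<in>D. if u \<in> S then \<Prod>v\<in>V-S. w u v else 1)" by simp
    also have "\<dots> = (\<Prod>u\<in>{u\<in>D. u \<in> S}. \<Prod>v\<in>V-S. w u v)"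
      by (rule prod.inter_filter[symmetric]) (rule finD)
    also have "{u\<in>D. u \<in> S} = S" using sub by auto
    finally show ?thesis .
  qed
  finally show ?thesis
    unfolding maj_quinv_eq_prod[OF t rf, of q] maj_quinv_eq_prod[OF t tf, of q] D_def w_def V_def .
qed

lemma C_ser_swap_nonzero:
  fixes q t :: "'a::field"
  assumes t: "t \<noteq> 0" and k: "1 \<le> k"
  shows "C_ser lam q t (\<alpha> \<circ> transpose k (Suc k)) = C_ser lam q t \<alpha>"
proof -
  define \<beta> where "\<beta> = \<alpha> \<circ> transpose k (Suc k)"
  have bk: "\<beta> (Suc k) = \<alpha> k" "merge_cont k \<beta> = merge_cont k \<alpha>"
    by (auto simp: \<beta>_def merge_cont_def fun_eq_iff transpose_def)
  define T where "T = {\<tau> \<in> posfillings lam. content lam \<tau> = merge_cont k \<alpha>}"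
  have "(\<Sum>S\<in>{S \<in> Pow (kcells lam k \<tau>). card S = \<alpha> k}. q ^ maj lam (raise k \<tau> S) * t ^ quinv lam (raise k \<tau> S)) =
        (\<Sum>S\<in>{S \<in> Pow (kcells lam k \<tau>). card S = \<alpha> (Suc k)}. q ^ maj lam (raise k \<tau> S) * t ^ quinv lam (raise k \<tau> S))"
    if "\<tau> \<in> T" for \<tau>
  proof -
    define V where "V = kcells lam k \<tau>"
    have finV: "finite V" by (simp add: V_def finite_kcells)
    have tau: "\<tau> \<in> posfillings lam" "content lam \<tau> = merge_cont k \<alpha>" using that by (auto simp: T_def)
    note e = kcells_Suc_empty[OF tau(2)]
    have cV: "card V = \<alpha> k + \<alpha> (Suc k)"
      using fun_cong[OF tau(2), of k] by (simp add: content_eq_card_kcells merge_cont_def V_def)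
    define X where "X = (\<lambda>S. \<Prod>u\<in>S. \<Prod>v\<in>V-S. cell_weight lam q t u v)"
    define W where "W = q ^ maj lam \<tau> * t ^ quinv lam \<tau>"
    have red: "(\<Sum>S\<in>{S \<in> Pow V. card S = n}. q ^ maj lam (raise k \<tau> S) * t ^ quinv lam (raise k \<tau> S)) =
        W * (\<Sum>S\<in>{S \<in> Pow V. card S = n}. X S)" for n
      unfolding sum_distrib_left W_def X_def V_def
      by (intro sum.cong refl weight_raise[OF t tau(1) e]) auto
    have filt: "(\<Sum>S\<in>Pow V. (if P S then 1 else 0) * X S) = (\<Sum>S\<in>{S\<in>Pow V. P S}. X S)" for P
    proof -
      have "(\<Sum>S\<in>Pow V. (if P S then 1 else 0) * X S) = (\<Sum>S\<in>Pow V. if P S then X S else 0)"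
        by (intro sum.cong) auto
      also have "\<dots> = (\<Sum>S\<in>{S\<in>Pow V. P S}. X S)"
        by (rule sum.inter_filter[symmetric]) (simp add: finV)
      finally show ?thesis .
    qed
    \<comment> \<open>The indicator of one cardinality as \<open>g\<close> extracts a single
      homogeneous piece of the two-letter sum.\<close>
    have "(\<Sum>S\<in>Pow V. (if card S = \<alpha> k then 1 else 0) * X S) =
       (\<Sum>S\<in>Pow V. (if card (V - S) = \<alpha> k then 1 else 0) * X S)"
      unfolding X_def
      by (rule two_letter_symmetry[OF finV, where t = t and g = "\<lambda>n. if n = \<alpha> k then 1 else 0"])
        (use cell_weight_neq_1[of lam q t] in blast)
    then have "(\<Sum>S\<in>{S\<in>Pow V. card S = \<alpha> k}. X S) = (\<Sum>S\<in>{S\<in>Pow V. card (V - S) = \<alpha> k}. X S)"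
      by (simp only: filt)
    also have "{S\<in>Pow V. card (V - S) = \<alpha> k} = {S\<in>Pow V. card S = \<alpha> (Suc k)}"
    proof -
      have "card (V - S) = \<alpha> k \<longleftrightarrow> card S = \<alpha> (Suc k)" if "S \<subseteq> V" for S
        using card_Diff_subset[of S V] card_mono[OF finV that] finite_subset[OF that finV] that cV by auto
      then show ?thesis by blast
    qed
    finally show ?thesis using red by (simp add: V_def)
  qed
  then show ?thesis
    unfolding \<beta>_def[symmetric] C_ser_eq_merged[OF k, of _ _ _ \<alpha>] C_ser_eq_merged[OF k, of _ _ _ \<beta>] bk
    by (auto simp: T_def intro!: sum.cong)
qed

text \<open>Here \<open>[:0, 1:]\<close> is \<open>t\<close> as an indeterminate, with
  \<open>q\<close> kept constant.\<close>

lemma poly_C_ser: "poly (C_ser lam [:q:] [:0, 1:] \<alpha>) x = C_ser lam q (x :: 'a::field_char_0) \<alpha>"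
  by (simp add: C_ser_def poly_sum)

lemma adj_symmetric_C_ser: "adj_symmetric (C_ser lam q (t :: 'a::field_char_0))"
  unfolding adj_symmetric_def
proof (intro allI impI)
  fix \<alpha> and k :: nat assume k: "1 \<le> k"
  define p where "p = C_ser lam [:q:] [:0, 1:] (\<alpha> \<circ> transpose k (Suc k)) - C_ser lam [:q:] [:0, 1:] \<alpha>"
  have "UNIV - {0} \<subseteq> {x. poly p x = 0}"
    using C_ser_swap_nonzero[OF _ k, of _ lam q \<alpha>] by (auto simp: p_def poly_C_ser)
  moreover have "infinite (UNIV - {0 :: 'a})" by (simp add: infinite_UNIV_char_0)
  ultimately have "infinite {x. poly p x = 0}" using finite_subset by blast
  then have "p = 0" using poly_roots_finite by blast
  then have "poly p t = 0" by simp
  then show "C_ser lam q t (\<alpha> \<circ> transpose k (Suc k)) = C_ser lam q t \<alpha>"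
    by (simp add: p_def poly_C_ser)
qed

section \<open>Non-attacking fillings and dominance\<close>

text \<open>It depends on absolute values alone, so toggling preserves it and its last cell, which
  makes the cancellation an involution.\<close>

definition clash :: "nat list \<Rightarrow> (nat \<times> nat \<Rightarrow> letter) \<Rightarrow> (nat \<times> nat) set" where
  "clash lam \<sigma> = {u \<in> dg lam. \<exists>v\<in>dg lam. att u v \<and> fst (\<sigma> u) = fst (\<sigma> v)}"

lemma finite_clash: "finite (clash lam \<sigma>)"
  by (simp add: clash_def finite_dg)

lemma nonattacking_iff_clash: "nonattacking lam \<sigma> \<longleftrightarrow> clash lam \<sigma> = {}"
proof
  assume n: "nonattacking lam \<sigma>"
  have "fst (\<sigma> u) \<noteq> fst (\<sigma> v)" if "u \<in> dg lam" "v \<in> dg lam" "att u v" for u v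
  proof (cases "fst u = fst v")
    case True
    then have "attacking v u" using that(3) by (auto simp: att_def attacking_def)
    then show ?thesis using n that by (metis nonattacking_def)
  next
    case False
    then have "attacking u v" using that(3) by (auto simp: att_def attacking_def)
    then show ?thesis using n that by (metis nonattacking_def)
  qed
  then show "clash lam \<sigma> = {}" by (auto simp: clash_def)
next
  assume e: "clash lam \<sigma> = {}"
  then have c: "fst (\<sigma> u) \<noteq> fst (\<sigma> v)" if "u \<in> dg lam" "v \<in> dg lam" "att u v" for u v
    using that by (auto simp: clash_def)
  show "nonattacking lam \<sigma>"
    unfolding nonattacking_def
  proof (intro ballI impI)
    fix u v assume uv: "u \<in> dg lam" "v \<in> dg lam" "attacking u v"
    then have "att u v \<or> att v u" by (auto simp: attacking_def att_def)
    then show "fst (\<sigma> u) \<noteq> fst (\<sigma> v)" using c uv by metis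
  qed
qed

lemma clash_toggle [simp]: "clash lam (toggle p \<sigma>) = clash lam \<sigma>"
  by (simp add: clash_def)

lemma Iv_toggle: "Iv (toggle p \<sigma> u) (toggle p \<sigma> v) \<longleftrightarrow>
    (if u = p \<and> fst (\<sigma> u) = fst (\<sigma> v) then \<not> snd (\<sigma> p) else Iv (\<sigma> u) (\<sigma> v))"
  by (auto simp: Iv_iff toggle_def)

text \<open>The last clashing cell attacks exactly one later cell with the same absolute value,
  and the cell below it has a different one.\<close>

lemma toggle_last_clash:
  assumes s: "\<sigma> \<in> fills (dg lam)" and ne: "clash lam \<sigma> \<noteq> {}"
    and p: "p = Min (clash lam \<sigma>)" and pos: "\<not> snd (\<sigma> p)"
  shows "maj lam (toggle p \<sigma>) = maj lam \<sigma>" "quinv lam (toggle p \<sigma>) = Suc (quinv lam \<sigma>)"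
proof -
  have pc: "p \<in> clash lam \<sigma>" using Min_in[OF finite_clash ne] p by simp
  have last: "x \<notin> clash lam \<sigma>" if "x < p" for x
    using Min_le[OF finite_clash, of x lam \<sigma>] that p by auto
  obtain v0 where pD: "p \<in> dg lam" and v0: "v0 \<in> dg lam" "att p v0" "fst (\<sigma> p) = fst (\<sigma> v0)"
    using pc by (auto simp: clash_def)
  have noclash: "\<not> att x y" if "x \<in> dg lam" "y \<in> dg lam" "x < p" "fst (\<sigma> x) = fst (\<sigma> y)" for x y
    using last[OF that(3)] that by (auto simp: clash_def)
  have v0p: "v0 < p" using att_or_above_less v0(2) by blast
  \<comment> \<open>Of two such targets the earlier one lies between \<open>p\<close> and the later
    one and so attacks the latter: a clash after \<open>p\<close>.\<close>
  have unique: "v = v0" if v: "v \<in> dg lam" "att p v" "fst (\<sigma> p) = fst (\<sigma> v)" for v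
  proof (rule ccontr)
    assume "v \<noteq> v0"
    then consider "v < v0" | "v0 < v" by (meson linorder_neqE)
    then show False
    proof cases
      case 1
      then have "att v0 v" using att_between[of p v v0] v(2) v0p by blast
      then show False using noclash[OF v0(1) v(1) v0p] v0(3) v(3) by simp
    next
      case 2
      have "v < p" using att_or_above_less v(2) by blast
      then have "att v v0" using att_between[of p v0 v] v0(2) 2 by blast
      then show False using noclash[OF v(1) v0(1) \<open>v < p\<close>] v0(3) v(3) by simp
    qed
  qed
  \<comment> \<open>Every cell attacked by \<open>p\<close> precedes the cell below \<open>p\<close>
    and attacks it, so equality here would again be a clash after \<open>p\<close>.\<close>
  have below: "fst (\<sigma> p) \<noteq> fst (\<sigma> v)" if v: "v \<in> dg lam" "directly_above p v" for v
  proof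
    assume eq: "fst (\<sigma> p) = fst (\<sigma> v)"
    have "v < v0" using att_above_less[OF v0(2) v(2)] .
    then have "att v0 v" using att_between[of p v v0] v(2) v0p by blast
    then show False using noclash[OF v0(1) v(1) v0p] v0(3) eq by simp
  qed
  have des: "is_descent lam (toggle p \<sigma>) u = is_descent lam \<sigma> u" for u
    unfolding is_descent_iff Iv_toggle using below by auto
  then show "maj lam (toggle p \<sigma>) = maj lam \<sigma>" by (simp add: maj_def)
  \<comment> \<open>The tie between \<open>p\<close> and \<open>v0\<close> counts exactly when
    \<open>p\<close> is negative, and it is the only attacking tie with \<open>p\<close> as first
    cell.\<close>
  have "att_inv lam (toggle p \<sigma>) = insert (p, v0) (att_inv lam \<sigma>)"
  proof (intro equalityI subsetI)
    fix x assume "x \<in> att_inv lam (toggle p \<sigma>)"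
    then show "x \<in> insert (p, v0) (att_inv lam \<sigma>)"
      using unique by (auto simp: att_inv_def Iv_toggle split: if_splits)
  next
    fix x assume "x \<in> insert (p, v0) (att_inv lam \<sigma>)"
    then show "x \<in> att_inv lam (toggle p \<sigma>)"
      using pD v0 pos by (auto simp: att_inv_def Iv_toggle)
  qed
  moreover have "(p, v0) \<notin> att_inv lam \<sigma>" using v0 pos by (auto simp: att_inv_def Iv_iff)
  ultimately have "card (att_inv lam (toggle p \<sigma>)) = Suc (card (att_inv lam \<sigma>))"
    by (simp add: finite_att_inv)
  then show "quinv lam (toggle p \<sigma>) = Suc (quinv lam \<sigma>)"
    using quinv_add_des_arm[OF s] quinv_add_des_arm[OF toggle_in_fills[OF s pD]] des by simp
qed

lemma npos_toggle:
  assumes "p \<in> dg lam" "\<not> snd (\<sigma> p)"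
  shows "npos lam \<sigma> = Suc (npos lam (toggle p \<sigma>))"
proof -
  have "{u\<in>dg lam. \<not> snd (\<sigma> u)} = insert p {u\<in>dg lam. \<not> snd (toggle p \<sigma> u)}"
    "p \<notin> {u\<in>dg lam. \<not> snd (toggle p \<sigma> u)}"
    using assms by (auto simp: toggle_def)
  then show ?thesis by (simp add: npos_def finite_dg)
qed

lemma S_ser_eq_full_sum:
  fixes q t :: "'a::field_char_0"
  shows "S_ser lam q t \<alpha> = full_sum (dg lam) (\<lambda>_. 1) (\<lambda>\<sigma>. q ^ maj lam \<sigma> * t ^ quinv lam \<sigma>) t \<alpha>"
proof -
  define f where "f = (\<lambda>\<sigma>. (-1) ^ nneg lam \<sigma> * q ^ maj lam \<sigma> * t ^ (npos lam \<sigma> + quinv lam \<sigma>))"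
  define A where "A = {\<sigma> \<in> fills (dg lam). content lam \<sigma> = \<alpha>}"
  define B where "B = {\<sigma> \<in> A. \<not> nonattacking lam \<sigma>}"
  have finA: "finite A"
    unfolding A_def content_eq_acont by (rule finite_fills_acont[OF finite_dg]) simp
  have "sum f B = 0"
  proof (rule sum_sign_reversing)
    fix \<sigma> assume "\<sigma> \<in> B"
    then have s: "\<sigma> \<in> fills (dg lam)" "content lam \<sigma> = \<alpha>" "clash lam \<sigma> \<noteq> {}"
      by (auto simp: B_def A_def nonattacking_iff_clash)
    define p where "p = Min (clash lam \<sigma>)"
    have pD: "p \<in> dg lam" using Min_in[OF finite_clash s(3)] by (simp add: p_def clash_def)
    let ?h = "\<lambda>\<sigma>. toggle (Min (clash lam \<sigma>)) \<sigma>"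
    show "?h (?h \<sigma>) = \<sigma>" by simp
    show "?h \<sigma> \<in> B"
      using s pD by (auto simp: B_def A_def nonattacking_iff_clash p_def[symmetric] toggle_in_fills content_eq_acont acont_toggle)
    \<comment> \<open>Making \<open>p\<close> negative lowers \<open>npos\<close> by one and raises
      \<open>quinv\<close> by one, so the power of \<open>t\<close> stays and only the sign
      changes.\<close>
    have pos: "f (toggle p \<sigma>) = - f \<sigma>"
      if s: "\<sigma> \<in> fills (dg lam)" "clash lam \<sigma> \<noteq> {}" "p = Min (clash lam \<sigma>)" "\<not> snd (\<sigma> p)" for \<sigma>
    proof -
      note tl = toggle_last_clash[OF s]
      have sg: "(-1 :: 'a) ^ nneg lam (toggle p \<sigma>) = - ((-1) ^ nneg lam \<sigma>)"
        unfolding nneg_def by (rule sign_toggle[OF finite_dg pD])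
      show ?thesis
        unfolding f_def sg tl npos_toggle[of p lam \<sigma>, OF pD s(4)] by simp
    qed
    show "f (?h \<sigma>) = - f \<sigma>"
    proof (cases "snd (\<sigma> p)")
      case False
      then show ?thesis using pos[of \<sigma>] s by (simp add: p_def)
    next
      case True
      \<comment> \<open>If \<open>p\<close> is negative, its toggle is positive there and has the
        same clashes, so the previous case applies with the roles exchanged.\<close>
      then have "f (toggle p (toggle p \<sigma>)) = - f (toggle p \<sigma>)"
        using s pD by (intro pos) (auto simp: toggle_in_fills p_def, simp add: toggle_def)
      then show ?thesis by (simp add: p_def[symmetric])
    qed
  qed
  moreover have "sum f A = sum f (A - B) + sum f B"
    using finA by (intro sum.subset_diff) (auto simp: B_def)
  moreover have "A - B = {\<sigma> \<in> superfillings lam. nonattacking lam \<sigma> \<and> content lam \<sigma> = \<alpha>}"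
    by (auto simp: A_def B_def superfillings_eq_fills)
  ultimately have "S_ser lam q t \<alpha> = sum f A" by (simp add: S_ser_def f_def)
  also have "\<dots> = full_sum (dg lam) (\<lambda>_. 1) (\<lambda>\<sigma>. q ^ maj lam \<sigma> * t ^ quinv lam \<sigma>) t \<alpha>"
    unfolding full_sum_def A_def f_def content_eq_acont nneg_def npos_def
    by (intro sum.cong refl) (simp add: power_add mult_ac)
  finally show ?thesis .
qed

section \<open>Contents, column counts and dominance\<close>

lemma sum_content:
  "is_exponent (content lam \<sigma>) \<and> (\<Sum>k | content lam \<sigma> k \<noteq> 0. content lam \<sigma> k) = card (dg lam)"
  if s: "\<sigma> \<in> superfillings lam"
proof -
  define g where "g = (\<lambda>u. fst (\<sigma> u))"
  have c: "content lam \<sigma> k = card {u\<in>dg lam. g u = k}" for k by (simp add: content_def g_def)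
  have supp: "{k. content lam \<sigma> k \<noteq> 0} = g ` dg lam"
    unfolding c using finite_dg by (auto simp: card_eq_0_iff)
  have "0 \<notin> g ` dg lam" using s fills_pos[of \<sigma> "dg lam"] by (force simp: superfillings_eq_fills g_def)
  then have "is_exponent (content lam \<sigma>)"
    using supp finite_dg by (auto simp: is_exponent_def)
  moreover have "(\<Sum>k | content lam \<sigma> k \<noteq> 0. content lam \<sigma> k) = card (dg lam)"
  proof -
    have "(\<Sum>k | content lam \<sigma> k \<noteq> 0. content lam \<sigma> k) = (\<Sum>k\<in>g ` dg lam. \<Sum>u\<in>{u\<in>dg lam. g u = k}. 1)"
      unfolding supp by (simp add: c)
    also have "\<dots> = (\<Sum>u\<in>dg lam. 1)" by (rule sum.image_gen[OF finite_dg, symmetric])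
    finally show ?thesis by simp
  qed
  ultimately show ?thesis ..
qed

lemma card_dg_columns: "card {u \<in> dg lam. snd u \<le> i} = sum_list (take i lam)"
proof -
  define n where "n = min i (length lam)"
  have "card {u \<in> dg lam. snd u \<le> i} = card (SIGMA j:{..<n}. {1..lam ! j})"
    by (rule bij_betw_same_card[of "\<lambda>(r, j). (j - 1, r)"], rule bij_betwI[where g = "\<lambda>(j, r). (r, Suc j)"])
      (auto simp: dg_def col_ht_def n_def)
  also have "\<dots> = (\<Sum>j<n. lam ! j)" by simp
  also have "\<dots> = sum_list (take i lam)"
    by (simp add: sum_list_sum_nth n_def atLeast0LessThan min.commute)
  finally show ?thesis .
qed

lemma card_dg: "card (dg lam) = sum_list lam"
proof -
  have "{u \<in> dg lam. snd u \<le> length lam} = dg lam" by (auto simp: dg_def)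
  then show ?thesis using card_dg_columns[of lam "length lam"] by simp
qed

lemma dg_left:
  assumes "is_partition lam" "(r, j) \<in> dg lam" "1 \<le> i" "i \<le> j"
  shows "(r, i) \<in> dg lam"
proof -
  have "lam ! (j - 1) \<le> lam ! (i - 1)"
  proof (cases "i = j")
    case False
    then show ?thesis using assms by (auto simp: is_partition_def dg_def sorted_wrt_iff_nth_less)
  qed simp
  then show ?thesis using assms by (auto simp: dg_def col_ht_def)
qed

text \<open>Row by row: entries of a row have distinct absolute values, so at most \<open>i\<close>
  of them lie in \<open>{1..i}\<close>. A row reaching column \<open>i\<close> has \<open>i\<close>
  cells in the first \<open>i\<close> columns; a shorter row lies in them entirely.\<close>

lemma card_small_entries_le:
  assumes lam: "is_partition lam" and na: "nonattacking lam \<sigma>"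
  shows "card {u \<in> dg lam. fst (\<sigma> u) \<in> {1..i}} \<le> card {u \<in> dg lam. snd u \<le> i}"
proof -
  define R where "R = fst ` dg lam"
  have rows: "card {u \<in> dg lam. P u} = (\<Sum>r\<in>R. card {u \<in> dg lam. P u \<and> fst u = r})" for P
  proof -
    have "(\<Sum>r\<in>R. \<Sum>u\<in>{u\<in>{u \<in> dg lam. P u}. fst u = r}. 1) = (\<Sum>u\<in>{u \<in> dg lam. P u}. 1 :: nat)"
      by (rule sum.group) (auto simp: R_def finite_dg)
    then show ?thesis by (simp add: conj_assoc)
  qed
  have "card {u \<in> dg lam. fst (\<sigma> u) \<in> {1..i} \<and> fst u = r} \<le> card {u \<in> dg lam. snd u \<le> i \<and> fst u = r}" for r
  proof (cases "\<forall>j\<in>{1..i}. (r, j) \<in> dg lam")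
    case True
    have "inj_on (\<lambda>u. fst (\<sigma> u)) {u \<in> dg lam. fst (\<sigma> u) \<in> {1..i} \<and> fst u = r}"
    proof (rule inj_onI)
      fix u v assume uv: "u \<in> {u \<in> dg lam. fst (\<sigma> u) \<in> {1..i} \<and> fst u = r}"
        "v \<in> {u \<in> dg lam. fst (\<sigma> u) \<in> {1..i} \<and> fst u = r}" "fst (\<sigma> u) = fst (\<sigma> v)"
      show "u = v"
      proof (rule ccontr)
        assume "u \<noteq> v"
        then have "attacking u v \<or> attacking v u"
          using uv by (auto simp: attacking_def prod_eq_iff)
        moreover have "u \<in> dg lam" "v \<in> dg lam" using uv by auto
        ultimately show False using na uv(3) unfolding nonattacking_def by metis
      qed
    qed
    then have "card {u \<in> dg lam. fst (\<sigma> u) \<in> {1..i} \<and> fst u = r} \<le> card {1..i}"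
      by (rule card_inj_on_le) auto
    also have "\<dots> = card (Pair r ` {1..i})" by (simp add: card_image inj_on_def)
    also have "\<dots> \<le> card {u \<in> dg lam. snd u \<le> i \<and> fst u = r}"
      using True by (intro card_mono) (auto simp: finite_dg)
    finally show ?thesis .
  next
    case False
    then obtain j0 where j0: "1 \<le> j0" "j0 \<le> i" "(r, j0) \<notin> dg lam" by auto
    have "snd u \<le> i" if "u \<in> dg lam" "fst u = r" for u
      using dg_left[OF lam, of r "snd u" j0] that j0 by (cases u) force
    then show ?thesis by (intro card_mono) (auto simp: finite_dg)
  qed
  then show ?thesis
    unfolding rows[of "\<lambda>u. fst (\<sigma> u) \<in> {1..i}"] rows[of "\<lambda>u. snd u \<le> i"] by (rule sum_mono)
qed

text \<open>For content \<open>pvec mu\<close> the number of cells with absolute value at most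
  \<open>i\<close> is the \<open>i\<close>-th partial sum of \<open>mu\<close>, while the first
  \<open>i\<close> columns hold the \<open>i\<close>-th partial sum of \<open>lam\<close>.\<close>

lemma dominated_if_nonattacking:
  assumes lam: "is_partition lam" and mu: "is_partition mu"
    and s: "\<sigma> \<in> superfillings lam" "nonattacking lam \<sigma>" "content lam \<sigma> = pvec mu"
  shows "dominated mu lam"
proof -
  have le: "sum_list (take i mu) \<le> sum_list (take i lam)" for i
  proof -
    have "sum_list (take i mu) = (\<Sum>j<min i (length mu). mu ! j)"
      by (simp add: sum_list_sum_nth atLeast0LessThan min.commute)
    also have "\<dots> = (\<Sum>k\<in>{1..min i (length mu)}. pvec mu k)"
      by (rule sum.reindex_bij_witness[of _ "\<lambda>k. k - 1" Suc]) (auto simp: pvec_def)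
    \<comment> \<open>\<open>pvec mu\<close> is 0 beyond the length of \<open>mu\<close>, so
      \<open>i\<close> may exceed it.\<close>
    also have "\<dots> = (\<Sum>k\<in>{1..i}. pvec mu k)"
      by (rule sum.mono_neutral_left) (auto simp: pvec_def)
    also have "\<dots> = (\<Sum>k\<in>{1..i}. \<Sum>u\<in>{u\<in>{u\<in>dg lam. fst (\<sigma> u) \<in> {1..i}}. fst (\<sigma> u) = k}. 1)"
    proof (rule sum.cong[OF refl])
      fix k assume "k \<in> {1..i}"
      then have "{u\<in>{u\<in>dg lam. fst (\<sigma> u) \<in> {1..i}}. fst (\<sigma> u) = k} = {u\<in>dg lam. fst (\<sigma> u) = k}" by auto
      then show "pvec mu k = (\<Sum>u\<in>{u\<in>{u\<in>dg lam. fst (\<sigma> u) \<in> {1..i}}. fst (\<sigma> u) = k}. 1)"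
        unfolding s(3)[symmetric] content_def by (simp only: card_eq_sum)
    qed
    also have "\<dots> = (\<Sum>u\<in>{u\<in>dg lam. fst (\<sigma> u) \<in> {1..i}}. 1)"
      by (rule sum.group) (auto simp: finite_dg)
    also have "\<dots> \<le> sum_list (take i lam)"
      using card_small_entries_le[OF lam s(2), of i] by (simp add: card_dg_columns)
    finally show ?thesis .
  qed
  have "sum_list mu = (\<Sum>k | pvec mu k \<noteq> 0. pvec mu k)"
  proof -
    have "sum_list mu = sum_mset (nzparts (pvec mu))" by (simp add: nzparts_pvec[OF mu] sum_mset_sum_list)
    then show ?thesis by (simp add: nzparts_def sum_unfold_sum_mset)
  qed
  also have "\<dots> = sum_list lam" using sum_content[OF s(1)] by (simp add: s(3) card_dg)
  finally show ?thesis using le by (simp add: dominated_def)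
qed

text \<open>The expansion is arbitrary. Hence the plethysm relation has a single value at
  \<open>C_ser\<close>, and the claim about every \<open>g\<close> reduces to one about
  \<open>S_ser\<close>.\<close>

lemma S_ser_eq_plethysm:
  fixes q t :: "'a::field_char_0"
  assumes fin: "finite {mu. a mu \<noteq> 0}" and part: "\<forall>mu. a mu \<noteq> 0 \<longrightarrow> is_partition mu"
    and C: "\<forall>\<alpha>. C_ser lam q t \<alpha> = (\<Sum>mu | a mu \<noteq> 0. a mu * of_nat (pcoeff mu \<alpha>))"
  shows "S_ser lam q t \<alpha> =
    (\<Sum>mu | a mu \<noteq> 0. a mu * (\<Prod>i<length mu. t ^ (mu ! i) - 1) * of_nat (pcoeff mu \<alpha>))"
proof (cases "is_exponent \<alpha>")
  case True
  show ?thesis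
    unfolding S_ser_eq_full_sum
  proof (rule full_sum_power_sum_expansion[OF superization_quinv fin _ _ True])
    show "super_sum (dg lam) (\<lambda>_. 1) (\<lambda>\<sigma>. q ^ maj lam \<sigma> * t ^ quinv lam \<sigma>) \<kappa> =
      (\<Sum>mu | a mu \<noteq> 0. a mu * of_nat (pcoeff mu (\<lambda>k. \<kappa> (k, False))))"
      if "\<forall>k. \<kappa> (k, True) = 0" for \<kappa>
      using C super_sum_eq_C_ser[OF that] by metis
  qed (use part in auto)
next
  case False
  \<comment> \<open>Both sides vanish: neither a filling nor a power sum produces an exponent that
    involves index 0 or has infinite support.\<close>
  then have e: "{\<sigma> \<in> superfillings lam. nonattacking lam \<sigma> \<and> content lam \<sigma> = \<alpha>} = {}"
    using sum_content by blast
  have "S_ser lam q t \<alpha> = 0" unfolding S_ser_def e by simp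
  moreover have "pcoeff mu \<alpha> = 0" if "a mu \<noteq> 0" for mu
  proof -
    have "is_partition mu" using part that by blast
    then have "pmaps mu \<alpha> = {}" using pmaps_is_exponent False by blast
    then show ?thesis by (simp add: pcoeff_eq_card_pmaps)
  qed
  then have "(\<Sum>mu | a mu \<noteq> 0. a mu * (\<Prod>i<length mu. t ^ (mu ! i) - 1) * of_nat (pcoeff mu \<alpha>)) = 0"
    by (intro sum.neutral) auto
  ultimately show ?thesis by simp
qed

theorem mainTheorem5:
  fixes lam :: "nat list" and q t :: "'a::field_char_0"
  assumes "is_partition lam"
  shows "pleth_Xt1 t (C_ser lam q t) (S_ser lam q t) \<and>
         (\<forall>g. pleth_Xt1 t (C_ser lam q t) g \<longrightarrow>
            (\<exists>c :: nat list \<Rightarrow> 'a. \<forall>\<alpha>. g \<alpha> =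
               (\<Sum>mu \<in> {mu. is_partition mu \<and> dominated mu lam}. c mu * of_nat (mcoeff mu \<alpha>))))"
proof
  \<comment> \<open>Homogeneity: every filling has as many entries as the diagram has cells.\<close>
  have "is_exponent \<alpha> \<and> (\<Sum>k | \<alpha> k \<noteq> 0. \<alpha> k) = card (dg lam)" if "C_ser lam q t \<alpha> \<noteq> 0" for \<alpha>
  proof -
    have "{\<sigma> \<in> posfillings lam. content lam \<sigma> = \<alpha>} \<noteq> {}"
      using that unfolding C_ser_def by (metis sum.empty)
    then show ?thesis using sum_content by (auto simp: posfillings_def)
  qed
  then obtain a where a: "finite {mu. a mu \<noteq> 0}" "\<forall>mu. a mu \<noteq> 0 \<longrightarrow> is_partition mu"
    "\<forall>\<alpha>. C_ser lam q t \<alpha> = (\<Sum>mu | a mu \<noteq> 0. a mu * of_nat (pcoeff mu \<alpha>))"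
    using power_sum_expansion[OF adj_symmetric_C_ser[of lam q t], of "card (dg lam)"] by blast
  have S: "S_ser lam q t \<alpha> = (\<Sum>mu | a mu \<noteq> 0. a mu * (\<Prod>i<length mu. t ^ (mu ! i) - 1) * of_nat (pcoeff mu \<alpha>))" for \<alpha>
    by (rule S_ser_eq_plethysm[OF a])
  then show "pleth_Xt1 t (C_ser lam q t) (S_ser lam q t)"
    unfolding pleth_Xt1_def using a by blast
  \<comment> \<open>Symmetry of the signed series is inherited from the power sums in its
    expansion.\<close>
  have sym: "adj_symmetric (S_ser lam q t)"
    using adj_symmetric_pcoeff by (simp add: adj_symmetric_def S)
  define M where "M = {mu. is_partition mu \<and> dominated mu lam}"
  have finM: "finite M"
    by (rule finite_subset[OF _ finite_partitions[of "sum_list lam"]]) (auto simp: M_def dominated_def)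
  \<comment> \<open>The coefficient of \<open>m_mu\<close> is the value at \<open>pvec mu\<close>.
    If \<open>nu\<close> is not dominated by \<open>lam\<close>, no non-attacking filling has
    content \<open>pvec nu\<close>, so the restricted sum loses nothing.\<close>
  have expand: "S_ser lam q t \<alpha> = (\<Sum>mu\<in>M. S_ser lam q t (pvec mu) * of_nat (mcoeff mu \<alpha>))" for \<alpha>
  proof (cases "is_exponent \<alpha>")
    case True
    then have m: "mcoeff mu \<alpha> = (if nzparts \<alpha> = mset mu then 1 else 0)" for mu
      by (simp add: mcoeff_def is_exponent_def nzparts_def)
    obtain nu where nu: "is_partition nu" "mset nu = nzparts \<alpha>"
      using ex_partition_nzparts[OF True] by blast
    have Snu: "S_ser lam q t \<alpha> = S_ser lam q t (pvec nu)"
      using adj_symmetric_nzparts[OF sym True is_exponent_pvec[OF nu(1)]] nzparts_pvec[OF nu(1)] nu(2) by simp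
    have one: "mcoeff mu \<alpha> = (if mu = nu then 1 else 0)" if "mu \<in> M" for mu
    proof -
      have "is_partition mu" using that by (simp add: M_def)
      then have "nzparts \<alpha> = mset mu \<longleftrightarrow> mu = nu" using is_partition_mset_eq nu by metis
      then show ?thesis by (simp add: m)
    qed
    have "(\<Sum>mu\<in>M. S_ser lam q t (pvec mu) * of_nat (mcoeff mu \<alpha>)) =
        (\<Sum>mu\<in>M. if mu = nu then S_ser lam q t (pvec nu) else 0)"
      using one by (intro sum.cong) auto
    also have "\<dots> = (if nu \<in> M then S_ser lam q t (pvec nu) else 0)" using finM by simp
    also have "\<dots> = S_ser lam q t (pvec nu)"
    proof (cases "nu \<in> M")
      case False
      then have e: "{\<sigma> \<in> superfillings lam. nonattacking lam \<sigma> \<and> content lam \<sigma> = pvec nu} = {}"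
        using dominated_if_nonattacking[OF assms nu(1)] nu(1) by (auto simp: M_def)
      show ?thesis using False unfolding S_ser_def e by simp
    qed simp
    finally show ?thesis using Snu by simp
  next
    case False
    then have "mcoeff mu \<alpha> = 0" for mu by (auto simp: mcoeff_def is_exponent_def)
    moreover have e: "{\<sigma> \<in> superfillings lam. nonattacking lam \<sigma> \<and> content lam \<sigma> = \<alpha>} = {}"
      using sum_content False by blast
    have "S_ser lam q t \<alpha> = 0" unfolding S_ser_def e by simp
    ultimately show ?thesis by simp
  qed
  show "\<forall>g. pleth_Xt1 t (C_ser lam q t) g \<longrightarrow>
      (\<exists>c :: nat list \<Rightarrow> 'a. \<forall>\<alpha>. g \<alpha> =
         (\<Sum>mu \<in> {mu. is_partition mu \<and> dominated mu lam}. c mu * of_nat (mcoeff mu \<alpha>)))"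
  proof (intro allI impI)
    fix g assume "pleth_Xt1 t (C_ser lam q t) g"
    then obtain b where b: "finite {mu. b mu \<noteq> 0}" "\<forall>mu. b mu \<noteq> 0 \<longrightarrow> is_partition mu"
      "\<forall>\<alpha>. C_ser lam q t \<alpha> = (\<Sum>mu | b mu \<noteq> 0. b mu * of_nat (pcoeff mu \<alpha>))"
      "\<forall>\<alpha>. g \<alpha> = (\<Sum>mu | b mu \<noteq> 0. b mu * (\<Prod>i<length mu. t ^ (mu ! i) - 1) * of_nat (pcoeff mu \<alpha>))"
      unfolding pleth_Xt1_def by blast
    have "g \<alpha> = S_ser lam q t \<alpha>" for \<alpha> using S_ser_eq_plethysm[OF b(1-3)] b(4) by simp
    then have "\<forall>\<alpha>. g \<alpha> = (\<Sum>mu\<in>M. S_ser lam q t (pvec mu) * of_nat (mcoeff mu \<alpha>))" using expand by metis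
    then show "\<exists>c :: nat list \<Rightarrow> 'a. \<forall>\<alpha>. g \<alpha> =
         (\<Sum>mu \<in> {mu. is_partition mu \<and> dominated mu lam}. c mu * of_nat (mcoeff mu \<alpha>))"
      unfolding M_def by (intro exI[of _ "\<lambda>mu. S_ser lam q t (pvec mu)"])
  qed
qed

end
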